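(* Given a closed-loop buck converter with a loop gain $T(s)$, saddle-node bifurcation (SNB) occurs when $$\sum_{n=-\infty}^{\infty} e^{j2n\pi D}\, T(jn\omega_s) = -1 .$$
   Context: Here $j=\sqrt{-1}$, $T$ (without argument) is the switching period while $T(s)$ denotes the loop gain, $\omega_s=2\pi/T$, $v_s$ is the source voltage, $V_h$ is the amplitude of the $T$-periodic ramp signal $h(t)$, and $D$ is the steady-state duty cycle. The switching instant $d=DT$ is determined by the intersection of the compensator output $y(t)$ with $h(t)$. The loop gain is $T(s)=G(s)v_s/V_h$, where $G(s)$ is the harmonic balance (HB) gain, i.e. the transfer function from $v_d$ (the voltage across the OFF switch or diode, a square wave with high voltage $v_s$ and low voltage $0$) to $-y$. With inductance $L$, capacitance $C$, load resistance $R$, equivalent series resistance $R_c$, and $\Delta(s)=LC(1+\frac{R_c}{R})s^2+(\frac LR+R_cC)s+1$, the transfer functions from $v_d$ to the output voltage and to the inductor current are $$G_v(s)=\frac{sR_cC+1}{\Delta(s)},\qquad G_i(s)=\frac{(1+\frac{R_c}{R})Cs+\frac1R}{\Delta(s)}.$$ With $G_c(s)$ the (voltage-loop) compensator transfer function, the HB gain is $G=G_cG_v$ for voltage mode control, $G=G_i$ for current mode control with voltage loop open, and $G=G_cG_v+G_i$ for current mode control with voltage loop closed. SNB refers to a saddle-node bifurcation of the $T$-periodic steady-state solution: it occurs when one eigenvalue of the Jacobian matrix of the linearized sampled-data (period-to-period) dynamics is $1$. *)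

theory Defs
  imports "HOL-Analysis.Analysis"
begin

text \<open>
  A converter is described by the vector field of its state for a given value of the voltage
  \<open>v\<^sub>d\<close> across the OFF switch or diode, together with the compensator output \<open>y\<close> as a function
  of the state. Sources other than \<open>v\<^sub>d\<close> (voltage reference, current command) are constants
  that enter the vector field and \<open>y\<close>.
\<close>

record 's converter =
  vfield :: "real \<Rightarrow> 's \<Rightarrow> 's"
  comp_output :: "'s \<Rightarrow> real"

text \<open>
  The vector fields used below are affine, so the solution through \<open>x\<close> exists on the whole real
  line and is unique.
\<close>

definition flow :: "('s \<Rightarrow> 's::real_normed_vector) \<Rightarrow> 's \<Rightarrow> real \<Rightarrow> 's" where
  "flow F x = (THE \<phi>. \<phi> 0 = x \<and> (\<forall>t. (\<phi> has_vector_derivative F (\<phi> t)) (at t)))"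

definition ramp :: "real \<Rightarrow> real \<Rightarrow> real \<Rightarrow> real \<Rightarrow> real" where
  "ramp Vl Vh Ts t = Vl + Vh * frac (t / Ts)"

text \<open>
  In each period \<open>v\<^sub>d\<close> equals \<open>v\<^sub>s\<close> until \<open>y\<close> first meets the ramp, and is \<open>0\<close> for the rest of the
  period. If \<open>y\<close> does not meet the ramp during the period, \<open>v\<^sub>d\<close> stays at \<open>v\<^sub>s\<close> throughout.
\<close>

definition switching_instant ::
    "'s::real_normed_vector converter \<Rightarrow> (real \<Rightarrow> real) \<Rightarrow> real \<Rightarrow> real \<Rightarrow> 's \<Rightarrow> real" where
  "switching_instant S h Ts vs x =
     Inf (insert Ts {t \<in> {0..<Ts}. comp_output S (flow (vfield S vs) x t) = h t})"

definition sampled_data_map ::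
    "'s::real_normed_vector converter \<Rightarrow> (real \<Rightarrow> real) \<Rightarrow> real \<Rightarrow> real \<Rightarrow> 's \<Rightarrow> 's" where
  "sampled_data_map S h Ts vs x =
     (let d = switching_instant S h Ts vs x
      in flow (vfield S 0) (flow (vfield S vs) x d) (Ts - d))"

text \<open>\<open>x\<close> is the state at the beginning of a period of the \<open>Ts\<close>-periodic solution.\<close>

definition periodic_steady_state ::
    "'s::real_normed_vector converter \<Rightarrow> (real \<Rightarrow> real) \<Rightarrow> real \<Rightarrow> real \<Rightarrow> real \<Rightarrow> 's \<Rightarrow> bool" where
  "periodic_steady_state S h Ts vs D x \<longleftrightarrow>
     sampled_data_map S h Ts vs x = x \<and> switching_instant S h Ts vs x = D * Ts"

text \<open>
  The slopes of \<open>y\<close>, just before switching, and of the ramp differ. Without this the switching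
  instant need not depend differentiably on the state, and there need not be a Jacobian.
\<close>

definition transversal_switching ::
    "'s::real_normed_vector converter \<Rightarrow> (real \<Rightarrow> real) \<Rightarrow> real \<Rightarrow> real \<Rightarrow> 's \<Rightarrow> bool" where
  "transversal_switching S h Ts vs x \<longleftrightarrow>
     (let d = switching_instant S h Ts vs x
      in deriv (\<lambda>t. comp_output S (flow (vfield S vs) x t)) d \<noteq> deriv h d)"

text \<open>The Jacobian of the sampled-data map is taken as a linear map, its Frechet derivative.\<close>

definition saddle_node_bifurcation :: "('s \<Rightarrow> 's::real_normed_vector) \<Rightarrow> 's \<Rightarrow> bool" where
  "saddle_node_bifurcation P x \<longleftrightarrow>
     (\<exists>J. (P has_derivative J) (at x) \<and> (\<exists>v. v \<noteq> 0 \<and> J v = 1 *\<^sub>R v))"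

text \<open>
  Power stage with state (inductor current, capacitor voltage). The output voltage
  \<open>v\<^sub>o = v\<^sub>C + R\<^sub>c (i\<^sub>L - v\<^sub>o / R)\<close> includes the drop across the series resistance of the capacitor;
  the circuit equations are \<open>L i\<^sub>L' = v\<^sub>d - v\<^sub>o\<close> and \<open>C v\<^sub>C' = i\<^sub>L - v\<^sub>o / R\<close>.
\<close>

definition output_voltage :: "real \<Rightarrow> real \<Rightarrow> real \<times> real \<Rightarrow> real" where
  "output_voltage R Rc p = R / (R + Rc) * (snd p + Rc * fst p)"

definition power_stage ::
    "real \<Rightarrow> real \<Rightarrow> real \<Rightarrow> real \<Rightarrow> real \<Rightarrow> real \<times> real \<Rightarrow> real \<times> real" where
  "power_stage L C R Rc vd p =
     ((vd - output_voltage R Rc p) / L, (fst p - output_voltage R Rc p / R) / C)"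

text \<open>
  The compensator is a proper linear system driven by the error \<open>v\<^sub>r - v\<^sub>o\<close>, in state-space form
  \<open>w' = A w + (v\<^sub>r - v\<^sub>o) b\<close> with output \<open>c \<bullet> w + \<delta> (v\<^sub>r - v\<^sub>o)\<close>. The realization need not be minimal,
  so a static gain is included (\<open>c = 0\<close>).
\<close>

definition compensated_field ::
    "real \<Rightarrow> real \<Rightarrow> real \<Rightarrow> real \<Rightarrow> real^'m^'m \<Rightarrow> real^'m \<Rightarrow> real
      \<Rightarrow> real \<Rightarrow> (real \<times> real) \<times> (real^'m) \<Rightarrow> (real \<times> real) \<times> (real^'m)" where
  "compensated_field L C R Rc A b vr vd x =
     (power_stage L C R Rc vd (fst x),
      A *v snd x + (vr - output_voltage R Rc (fst x)) *\<^sub>R b)"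

definition voltage_compensator_output ::
    "real \<Rightarrow> real \<Rightarrow> real^'m \<Rightarrow> real \<Rightarrow> real \<Rightarrow> (real \<times> real) \<times> (real^'m) \<Rightarrow> real" where
  "voltage_compensator_output R Rc c \<delta> vr x =
     c \<bullet> snd x + \<delta> * (vr - output_voltage R Rc (fst x))"

definition voltage_mode ::
    "real \<Rightarrow> real \<Rightarrow> real \<Rightarrow> real \<Rightarrow> real^'m^'m \<Rightarrow> real^'m \<Rightarrow> real^'m \<Rightarrow> real \<Rightarrow> real
      \<Rightarrow> ((real \<times> real) \<times> (real^'m)) converter" where
  "voltage_mode L C R Rc A b c \<delta> vr =
     \<lparr>vfield = compensated_field L C R Rc A b vr,
      comp_output = voltage_compensator_output R Rc c \<delta> vr\<rparr>"

definition current_mode_open ::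
    "real \<Rightarrow> real \<Rightarrow> real \<Rightarrow> real \<Rightarrow> real \<Rightarrow> (real \<times> real) converter" where
  "current_mode_open L C R Rc ic =
     \<lparr>vfield = power_stage L C R Rc, comp_output = (\<lambda>p. ic - fst p)\<rparr>"

definition current_mode_closed ::
    "real \<Rightarrow> real \<Rightarrow> real \<Rightarrow> real \<Rightarrow> real^'m^'m \<Rightarrow> real^'m \<Rightarrow> real^'m \<Rightarrow> real \<Rightarrow> real
      \<Rightarrow> ((real \<times> real) \<times> (real^'m)) converter" where
  "current_mode_closed L C R Rc A b c \<delta> vr =
     \<lparr>vfield = compensated_field L C R Rc A b vr,
      comp_output = (\<lambda>x. voltage_compensator_output R Rc c \<delta> vr x - fst (fst x))\<rparr>"

definition buck_denominator :: "real \<Rightarrow> real \<Rightarrow> real \<Rightarrow> real \<Rightarrow> complex \<Rightarrow> complex" where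
  "buck_denominator L C R Rc s =
     of_real (L * C * (1 + Rc / R)) * s\<^sup>2 + of_real (L / R + Rc * C) * s + 1"

definition Gv :: "real \<Rightarrow> real \<Rightarrow> real \<Rightarrow> real \<Rightarrow> complex \<Rightarrow> complex" where
  "Gv L C R Rc s = (s * of_real (Rc * C) + 1) / buck_denominator L C R Rc s"

definition Gi :: "real \<Rightarrow> real \<Rightarrow> real \<Rightarrow> real \<Rightarrow> complex \<Rightarrow> complex" where
  "Gi L C R Rc s =
     (of_real ((1 + Rc / R) * C) * s + of_real (1 / R)) / buck_denominator L C R Rc s"

definition characteristic_matrix :: "real^'m^'m \<Rightarrow> complex \<Rightarrow> complex^'m^'m" where
  "characteristic_matrix A s = mat s - (\<chi> i j. of_real (A $ i $ j))"

text \<open>The compensator transfer function \<open>c\<^sup>T (s I - A)\<^sup>-\<^sup>1 b + \<delta>\<close>.\<close>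

definition Gc :: "real^'m^'m \<Rightarrow> real^'m \<Rightarrow> real^'m \<Rightarrow> real \<Rightarrow> complex \<Rightarrow> complex" where
  "Gc A b c \<delta> s =
     (\<Sum>i\<in>UNIV. of_real (c $ i) *
        (matrix_inv (characteristic_matrix A s) *v (\<chi> k. of_real (b $ k))) $ i) + of_real \<delta>"

definition loop_gain :: "(complex \<Rightarrow> complex) \<Rightarrow> real \<Rightarrow> real \<Rightarrow> complex \<Rightarrow> complex" where
  "loop_gain G vs Vh s = G s * of_real vs / of_real Vh"

text \<open>
  A series over all integers, understood as the limit of its symmetric partial sums: loop gains
  of relative degree one decay only like \<open>1 / n\<close>, and absolute summability fails.
\<close>

definition bilateral_sums :: "(int \<Rightarrow> complex) \<Rightarrow> complex \<Rightarrow> bool" where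
  "bilateral_sums a l \<longleftrightarrow> (\<lambda>N. \<Sum>n = - int N..int N. a n) \<longlonglongrightarrow> l"

definition loop_gain_harmonic :: "(complex \<Rightarrow> complex) \<Rightarrow> real \<Rightarrow> real \<Rightarrow> int \<Rightarrow> complex" where
  "loop_gain_harmonic T D \<omega>s n =
     exp (\<i> * of_real (2 * of_int n * pi * D)) * T (\<i> * of_real (of_int n * \<omega>s))"

end

theory Submission
  imports Defs
begin

text \<open>
  Each converter is switched affine: \<open>x' = M x + v\<^sub>d \<beta> + r\<close> and \<open>y = K x + \<kappa>\<close>. Write \<open>E t = exp (t M)\<close>,
  let \<open>d = D Ts\<close>, and let \<open>u\<close> solve \<open>u - E Ts u = \<beta>\<close>, which is possible since no \<open>\<i> n \<omega>\<^sub>s\<close> is an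
  eigenvalue of \<open>M\<close>. With \<open>\<gamma>\<close> the slope of \<open>y\<close> minus that of the ramp at \<open>d\<close>, the Jacobian of the
  sampled-data map is \<open>v \<mapsto> E Ts v - (v\<^sub>s / \<gamma>) K (E d v) E (Ts - d) \<beta>\<close>, a rank-one perturbation of
  \<open>E Ts\<close>; it has the eigenvalue \<open>1\<close> iff \<open>\<gamma> = - v\<^sub>s K (E Ts u)\<close>. Periodicity of the steady state gives
  \<open>\<gamma> = v\<^sub>s K (E d u - E Ts u) - V\<^sub>h / Ts\<close>, so the condition becomes \<open>v\<^sub>s K (E d u) = V\<^sub>h / Ts\<close>.
  Integration by parts shows that the \<open>n\<close>-th Fourier coefficient on \<open>[0, Ts]\<close> of \<open>t \<mapsto> K (E t u)\<close> is
  \<open>K ((\<i> n \<omega>\<^sub>s - M)\<^sup>-\<^sup>1 \<beta>) / Ts = - G (\<i> n \<omega>\<^sub>s) / Ts\<close>, and the Fourier series at the interior point \<open>d\<close> turns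
  the condition into the one on the loop gain.
\<close>

subsection \<open>Linear and affine flows\<close>

lemma has_vector_derivative_componentwise:
  fixes f :: "real \<Rightarrow> 'a::euclidean_space"
  shows "(f has_vector_derivative f') (at t) \<longleftrightarrow>
    (\<forall>i\<in>Basis. ((\<lambda>t. f t \<bullet> i) has_real_derivative f' \<bullet> i) (at t))"
  unfolding has_vector_derivative_def has_derivative_componentwise_within[of f]
    has_field_derivative_def
  by (simp add: mult_commute_abs)

text \<open>The exponential \<open>exp (t M)\<close> applied to \<open>x\<close>. \<open>M\<close>
  is a linear map and not a matrix because the states are nested pairs such as
  \<open>(real \<times> real) \<times> (real^'m)\<close>.\<close>

definition linear_flow :: "('a \<Rightarrow> 'a) \<Rightarrow> real \<Rightarrow> 'a \<Rightarrow> 'a::euclidean_space" where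
  "linear_flow M t x = (\<Sum>n. (t ^ n / fact n) *\<^sub>R (M ^^ n) x)"

lemma linear_funpow:
  fixes M :: "'a::real_vector \<Rightarrow> 'a"
  assumes "linear M"
  shows "linear (M ^^ n)"
proof (induction n)
  case 0
  then show ?case by (simp add: linear_id[unfolded id_def] id_def)
next
  case (Suc n)
  then show ?case using linear_compose[OF Suc assms] by (simp add: o_def)
qed

text \<open>Since \<open>norm ((M ^^ n) x)\<close> grows at most like \<open>B ^ n\<close>, the
  exponential series of \<open>\<bar>t\<bar> * B\<close> dominates.\<close>

lemma linear_flow_sums:
  fixes M :: "'a::euclidean_space \<Rightarrow> 'a"
  assumes "linear M"
  shows "(\<lambda>n. (t ^ n / fact n) *\<^sub>R (M ^^ n) x) sums linear_flow M t x"
proof -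
  obtain B where B: "B > 0" "\<And>x. norm (M x) \<le> B * norm x"
    using linear_bounded_pos[OF assms] by metis
  have pow: "norm ((M ^^ n) x) \<le> B ^ n * norm x" for n
  proof (induction n)
    case (Suc n)
    have "norm ((M ^^ Suc n) x) \<le> B * norm ((M ^^ n) x)" using B by simp
    also have "\<dots> \<le> B * (B ^ n * norm x)" using Suc B by (intro mult_left_mono) auto
    finally show ?case by (simp add: algebra_simps)
  qed simp
  have "summable (\<lambda>n. inverse (fact n) * (\<bar>t\<bar> * B) ^ n * norm x)"
    by (intro summable_mult2 summable_exp)
  then have "summable (\<lambda>n. (t ^ n / fact n) *\<^sub>R (M ^^ n) x)"
  proof (rule summable_comparison_test'[where N = 0])
    fix n :: nat
    have "norm ((t ^ n / fact n) *\<^sub>R (M ^^ n) x) = \<bar>t\<bar> ^ n / fact n * norm ((M ^^ n) x)"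
      by (simp add: power_abs)
    also have "\<dots> \<le> \<bar>t\<bar> ^ n / fact n * (B ^ n * norm x)"
      by (intro mult_left_mono pow) auto
    finally show "norm ((t ^ n / fact n) *\<^sub>R (M ^^ n) x) \<le> inverse (fact n) * (\<bar>t\<bar> * B) ^ n * norm x"
      by (simp add: field_simps power_mult_distrib)
  qed
  then show ?thesis by (simp add: linear_flow_def summable_sums)
qed

lemma linear_linear_flow:
  fixes M :: "'a::euclidean_space \<Rightarrow> 'a"
  assumes "linear M"
  shows "linear (linear_flow M t)"
proof (rule linearI)
  note lin = linear_funpow[OF assms]
  fix x y c
  have "(\<lambda>n. (t ^ n / fact n) *\<^sub>R (M ^^ n) (x + y)) sums (linear_flow M t x + linear_flow M t y)"
    using sums_add[OF linear_flow_sums[OF assms, of t x] linear_flow_sums[OF assms, of t y]]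
    by (simp add: linear_add[OF lin] scaleR_add_right)
  then show "linear_flow M t (x + y) = linear_flow M t x + linear_flow M t y"
    using linear_flow_sums[OF assms] sums_unique2 by blast
  have "(\<lambda>n. (t ^ n / fact n) *\<^sub>R (M ^^ n) (c *\<^sub>R x)) sums (c *\<^sub>R linear_flow M t x)"
    using sums_scaleR_right[OF linear_flow_sums[OF assms, of t x], of c]
    by (simp add: linear_scale[OF lin] mult.commute)
  then show "linear_flow M t (c *\<^sub>R x) = c *\<^sub>R linear_flow M t x"
    using linear_flow_sums[OF assms] sums_unique2 by blast
qed

lemma linear_flow_0 [simp]: "linear_flow M 0 x = x"
proof -
  have "(\<Sum>n. (0 ^ n / fact n) *\<^sub>R (M ^^ n) x) = (\<Sum>n\<in>{0}. (0 ^ n / fact n) *\<^sub>R (M ^^ n) x)"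
    by (rule suminf_finite) auto
  then show ?thesis by (simp add: linear_flow_def)
qed

lemma linear_flow_commute:
  fixes M :: "'a::euclidean_space \<Rightarrow> 'a"
  assumes "linear M"
  shows "linear_flow M t (M x) = M (linear_flow M t x)"
proof -
  have "bounded_linear M" using assms by (simp add: linear_conv_bounded_linear)
  from bounded_linear.sums[OF this linear_flow_sums[OF assms, of t x]]
  have "(\<lambda>n. (t ^ n / fact n) *\<^sub>R (M ^^ n) (M x)) sums M (linear_flow M t x)"
    by (simp add: linear_scale[OF assms] funpow_swap1)
  then show ?thesis using linear_flow_sums[OF assms] sums_unique2 by blast
qed

text \<open>Each coordinate is a scalar power series converging for every \<open>t\<close>, so it
  may be differentiated termwise; its \<open>diffs\<close> series is the one that belongs to
  \<open>M x\<close>.\<close>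

lemma linear_flow_deriv:
  fixes M :: "'a::euclidean_space \<Rightarrow> 'a"
  assumes "linear M"
  shows "((\<lambda>t. linear_flow M t x) has_vector_derivative linear_flow M t (M x)) (at t)"
  unfolding has_vector_derivative_componentwise
proof
  fix i :: 'a assume "i \<in> Basis"
  define c where "c n = ((M ^^ n) x \<bullet> i) / fact n" for n
  have s: "(\<lambda>n. c n * t ^ n) sums (linear_flow M t x \<bullet> i)" for t
    using bounded_linear.sums[OF bounded_linear_inner_left linear_flow_sums[OF assms, of t x], of i]
    by (simp add: c_def field_simps)
  have s': "(\<lambda>n. diffs c n * t ^ n) sums (linear_flow M t (M x) \<bullet> i)" for t
    using bounded_linear.sums[OF bounded_linear_inner_left linear_flow_sums[OF assms, of t "M x"], of i]
    by (simp add: c_def diffs_def field_simps funpow_swap1 del: of_nat_Suc)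
  have "((\<lambda>t. \<Sum>n. c n * t ^ n) has_real_derivative (\<Sum>n. diffs c n * t ^ n)) (at t)"
    by (rule termdiffs_strong_converges_everywhere) (use s sums_summable in blast)
  then show "((\<lambda>t. linear_flow M t x \<bullet> i) has_real_derivative linear_flow M t (M x) \<bullet> i) (at t)"
    using sums_unique[OF s] sums_unique[OF s'] by simp
qed

text \<open>Product rule for a time-dependent operator acting on a moving vector. Expanding
  \<open>\<phi> t\<close> in \<open>Basis\<close> leaves a finite sum of scalar multiples of curves
  through fixed vectors.\<close>

lemma linear_flow_deriv_compose:
  fixes M :: "'a::euclidean_space \<Rightarrow> 'a"
  assumes M: "linear M"
    and g: "(g has_real_derivative g') (at t)"
    and \<phi>: "(\<phi> has_vector_derivative \<phi>') (at t)"
  shows "((\<lambda>t. linear_flow M (g t) (\<phi> t)) has_vector_derivative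
    linear_flow M (g t) (g' *\<^sub>R M (\<phi> t) + \<phi>')) (at t)"
proof -
  note lin = linear_linear_flow[OF M]
  have exp: "linear_flow M s x = (\<Sum>i\<in>Basis. (x \<bullet> i) *\<^sub>R linear_flow M s i)" for s x
    by (subst euclidean_representation[symmetric, of x])
      (simp only: linear_sum[OF lin] linear_scale[OF lin])
  have d: "((\<lambda>t. linear_flow M (g t) i) has_vector_derivative g' *\<^sub>R linear_flow M (g t) (M i)) (at t)" for i
    using vector_diff_chain_at[OF g[unfolded has_real_derivative_iff_has_vector_derivative]
        linear_flow_deriv[OF M]] by (simp add: o_def)
  have e: "((\<lambda>t. \<phi> t \<bullet> i) has_real_derivative \<phi>' \<bullet> i) (at t)" if "i \<in> Basis" for i
    using \<phi> that has_vector_derivative_componentwise by blast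
  have "((\<lambda>t. \<Sum>i\<in>Basis. (\<phi> t \<bullet> i) *\<^sub>R linear_flow M (g t) i) has_vector_derivative
     (\<Sum>i\<in>Basis. (\<phi> t \<bullet> i) *\<^sub>R (g' *\<^sub>R linear_flow M (g t) (M i)) + (\<phi>' \<bullet> i) *\<^sub>R linear_flow M (g t) i)) (at t)"
    by (intro has_vector_derivative_sum has_vector_derivative_scaleR d e)
  moreover have "(\<Sum>i\<in>Basis. (\<phi> t \<bullet> i) *\<^sub>R (g' *\<^sub>R linear_flow M (g t) (M i)) + (\<phi>' \<bullet> i) *\<^sub>R linear_flow M (g t) i)
    = g' *\<^sub>R M (linear_flow M (g t) (\<phi> t)) + linear_flow M (g t) \<phi>'"
    by (simp add: sum.distrib exp[of _ "\<phi> t"] exp[of _ \<phi>'] linear_sum[OF M] linear_scale[OF M]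
        scaleR_sum_right linear_flow_commute[OF M] mult.commute)
  ultimately show ?thesis
    by (simp add: exp[of _ "\<phi> _", symmetric] linear_add[OF lin] linear_scale[OF lin] linear_flow_commute[OF M])
qed

text \<open>The curve \<open>\<lambda>s. linear_flow M (t - s) (\<phi> s)\<close> has derivative
  zero; its values at \<open>t\<close> and \<open>0\<close> are the two sides.\<close>

lemma linear_flow_unique:
  fixes M :: "'a::euclidean_space \<Rightarrow> 'a"
  assumes M: "linear M"
    and \<phi>: "\<And>t. (\<phi> has_vector_derivative M (\<phi> t)) (at t)"
  shows "\<phi> t = linear_flow M t (\<phi> 0)"
proof -
  note lin = linear_linear_flow[OF M]
  have "((\<lambda>s. linear_flow M (t - s) (\<phi> s)) has_vector_derivative 0) (at s)" for s
    using linear_flow_deriv_compose[OF M _ \<phi>, of "\<lambda>s. t - s" "-1"]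
    by (force intro!: derivative_eq_intros simp: linear_0[OF lin])
  then have "((\<lambda>s. linear_flow M (t - s) (\<phi> s)) has_derivative (\<lambda>h. 0)) (at s)" for s
    by (simp add: has_vector_derivative_def)
  then obtain c where "\<And>s. linear_flow M (t - s) (\<phi> s) = c"
    using has_derivative_zero_constant[of UNIV "\<lambda>s. linear_flow M (t - s) (\<phi> s)"] by auto
  from this[of 0] this[of t] show ?thesis by simp
qed

lemma linear_flow_add:
  fixes M :: "'a::euclidean_space \<Rightarrow> 'a"
  assumes M: "linear M"
  shows "linear_flow M (s + t) x = linear_flow M s (linear_flow M t x)"
proof -
  have "((\<lambda>s. linear_flow M (s + t) x) has_vector_derivative M (linear_flow M (s + t) x)) (at s)" for s
    using linear_flow_deriv_compose[OF M, of "\<lambda>s. s + t" 1 s "\<lambda>_. x" 0]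
    by (simp add: linear_flow_commute[OF M] DERIV_add[OF DERIV_ident DERIV_const, simplified])
  from linear_flow_unique[OF M, OF this] show ?thesis by simp
qed

lemma linear_flow_eq_0_iff:
  fixes M :: "'a::euclidean_space \<Rightarrow> 'a"
  assumes M: "linear M"
  shows "linear_flow M t x = 0 \<longleftrightarrow> x = 0"
  using linear_flow_add[OF M, of "-t" t x] linear_0[OF linear_linear_flow[OF M]] by force

lemma continuous_on_linear_flow:
  fixes M :: "'a::euclidean_space \<Rightarrow> 'a"
  assumes M: "linear M"
  shows "continuous_on S (\<lambda>t. linear_flow M t x)"
  by (rule continuous_at_imp_continuous_on)
    (use has_vector_derivative_continuous[OF linear_flow_deriv[OF M]] in blast)

text \<open>The extra coordinate turns the affine equation into a linear one.\<close>

lemma affine_flow_exists: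
  fixes M :: "'a::euclidean_space \<Rightarrow> 'a"
  assumes M: "linear M"
  shows "\<exists>\<phi>. \<phi> 0 = x \<and> (\<forall>t. (\<phi> has_vector_derivative M (\<phi> t) + g) (at t))"
proof -
  define N :: "'a \<times> real \<Rightarrow> 'a \<times> real" where "N p = (M (fst p) + snd p *\<^sub>R g, 0)" for p
  have N: "linear N"
    by (rule linearI)
      (auto simp: N_def linear_add[OF M] linear_scale[OF M] scaleR_add_left scaleR_add_right)
  define \<psi> where "\<psi> t = linear_flow N t (x, 1)" for t
  have d: "(\<psi> has_vector_derivative N (\<psi> t)) (at t)" for t
    using linear_flow_deriv[OF N, of "(x, 1)"] by (simp add: \<psi>_def[abs_def] linear_flow_commute[OF N])
  have d2: "((\<lambda>t. snd (\<psi> t)) has_vector_derivative 0) (at t)" for t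
    using bounded_linear.has_vector_derivative[OF bounded_linear_snd d[of t]] by (simp add: N_def)
  have "((\<lambda>t. snd (\<psi> t)) has_derivative (\<lambda>h. 0)) (at t)" for t
    using d2 by (simp add: has_vector_derivative_def)
  then obtain c where c: "\<And>t. snd (\<psi> t) = c"
    using has_derivative_zero_constant[of UNIV "\<lambda>t. snd (\<psi> t)"] by auto
  have "snd (\<psi> 0) = 1" by (simp add: \<psi>_def)
  with c have "snd (\<psi> t) = 1" for t by metis
  then have "((\<lambda>t. fst (\<psi> t)) has_vector_derivative M (fst (\<psi> t)) + g) (at t)" for t
    using bounded_linear.has_vector_derivative[OF bounded_linear_fst d[of t]] by (simp add: N_def)
  moreover have "fst (\<psi> 0) = x" by (simp add: \<psi>_def)
  ultimately show ?thesis by (intro exI[of _ "\<lambda>t. fst (\<psi> t)"]) blast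
qed

lemma affine_flow_difference:
  fixes M :: "'a::euclidean_space \<Rightarrow> 'a"
  assumes M: "linear M"
    and "\<And>t. (\<phi> has_vector_derivative M (\<phi> t) + g) (at t)"
    and "\<And>t. (\<psi> has_vector_derivative M (\<psi> t) + g) (at t)"
  shows "\<phi> t = \<psi> t + linear_flow M t (\<phi> 0 - \<psi> 0)"
proof -
  have "((\<lambda>t. \<phi> t - \<psi> t) has_vector_derivative M (\<phi> t - \<psi> t)) (at t)" for t
    using has_vector_derivative_diff[OF assms(2)[of t] assms(3)[of t]]
    by (simp add: linear_diff[OF M])
  from linear_flow_unique[OF M, OF this, of t] show ?thesis by (simp add: algebra_simps)
qed

lemma affine_flow:
  fixes M :: "'a::euclidean_space \<Rightarrow> 'a"
  assumes M: "linear M" and F: "\<And>x. F x = M x + g"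
  shows affine_flow_0: "flow F x 0 = x"
    and affine_flow_deriv: "(flow F x has_vector_derivative F (flow F x t)) (at t)"
proof -
  \<comment> \<open>Two solutions with the same start differ by \<open>linear_flow M t 0\<close>,
    which is zero. Existence and uniqueness together resolve the \<open>THE\<close> in
    \<open>flow\<close>.\<close>
  have "\<exists>!\<phi>. \<phi> 0 = x \<and> (\<forall>t. (\<phi> has_vector_derivative F (\<phi> t)) (at t))"
    using affine_flow_exists[OF M, of x g] affine_flow_difference[OF M, of _ g]
      linear_0[OF linear_linear_flow[OF M]] unfolding F
    by (metis (no_types, lifting) add.right_neutral diff_self ext)
  from theI'[OF this] show "flow F x 0 = x"
    "(flow F x has_vector_derivative F (flow F x t)) (at t)"
    unfolding flow_def by auto
qed

text \<open>The difference of two solutions of the same affine equation solves the linear one, so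
  the solution depends on its initial state through a linear term only.\<close>

lemma affine_flow_shift:
  fixes M :: "'a::euclidean_space \<Rightarrow> 'a"
  assumes M: "linear M" and F: "\<And>x. F x = M x + g"
  shows "flow F x' t = flow F x t + linear_flow M t (x' - x)"
proof -
  note d = affine_flow_deriv[OF M F]
  have "flow F x' t = flow F x t + linear_flow M t (flow F x' 0 - flow F x 0)"
    using affine_flow_difference[OF M, of "flow F x'" g "flow F x" t] d unfolding F by blast
  then show ?thesis by (simp add: affine_flow_0[OF M F])
qed

text \<open>The velocity along a solution obeys the linear equation, because the constant
  \<open>g\<close> disappears on differentiation.\<close>

lemma affine_flow_field:
  fixes M :: "'a::euclidean_space \<Rightarrow> 'a"
  assumes M: "linear M" and F: "\<And>x. F x = M x + g"
  shows "F (flow F x t) = linear_flow M t (F x)"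
proof -
  have bl: "bounded_linear M" using M by (simp add: linear_conv_bounded_linear)
  have "((\<lambda>t. F (flow F x t)) has_vector_derivative M (F (flow F x t))) (at t)" for t
    using bounded_linear.has_vector_derivative[OF bl affine_flow_deriv[OF M F, of x t]]
    by (subst (1) F) (auto intro!: derivative_eq_intros)
  from linear_flow_unique[OF M, OF this, of t] show ?thesis by (simp add: affine_flow_0[OF M F])
qed

subsection \<open>Pointwise convergence of Fourier series\<close>

lemma has_vector_derivative_cis:
  "((\<lambda>t. cis (r * t)) has_vector_derivative (\<i> * of_real r * cis (r * t))) (at t within S)"
proof -
  have "((\<lambda>z. exp (\<i> * of_real r * z)) has_field_derivative \<i> * of_real r * exp (\<i> * of_real r * of_real t))
      (at (of_real t))"
    by (auto intro!: derivative_eq_intros)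
  from has_vector_derivative_real_field[OF this] show ?thesis
    by (simp add: cis_conv_exp mult.assoc has_vector_derivative_at_within)
qed

text \<open>Replacing \<open>g\<close> by a uniformly close polynomial \<open>p\<close> changes the
  integral by at most \<open>e / 2\<close> for every \<open>r\<close>; integration by parts bounds
  the integral with \<open>p\<close> by \<open>K / \<bar>r\<bar>\<close>.\<close>

lemma Riemann_Lebesgue_interval:
  fixes g :: "real \<Rightarrow> complex"
  assumes g: "continuous_on {a..b} g"
  shows "((\<lambda>r. integral {a..b} (\<lambda>t. g t * cis (r * t))) \<longlongrightarrow> 0) at_infinity"
proof (cases "a \<le> b")
  case True
  show ?thesis
  proof (rule tendstoI)
    fix e :: real assume e: "e > 0"
    \<comment> \<open>The summand 1 keeps the denominator positive when
      \<open>a = b\<close>.\<close>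
    define e' where "e' = e / (2 * (b - a + 1))"
    have e': "e' > 0" using e True by (simp add: e'_def)
    obtain p where p: "polynomial_function p" "\<And>t. t \<in> {a..b} \<Longrightarrow> norm (g t - p t) < e'"
      using Stone_Weierstrass_polynomial_function[OF compact_Icc g e'] by metis
    obtain p' where p': "polynomial_function p'" "\<And>t. (p has_vector_derivative p' t) (at t)"
      using has_vector_derivative_polynomial_function[OF p(1)] by metis
    have cp: "continuous_on {a..b} p" "continuous_on {a..b} p'"
      using p p' continuous_on_polymonial_function by blast+
    have cc: "continuous_on {a..b} (\<lambda>t. cis (r * t))" for r by (intro continuous_intros)
    obtain B where B: "\<And>t. t \<in> {a..b} \<Longrightarrow> norm (p' t) \<le> B"
      using compact_imp_bounded[OF compact_continuous_image[OF cp(2) compact_Icc]]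
      unfolding bounded_iff by blast
    define K where "K = norm (p b) + norm (p a) + B * (b - a)"
    have bound: "\<bar>r\<bar> * norm (integral {a..b} (\<lambda>t. p t * cis (r * t))) \<le> K" for r
    proof -
      let ?f' = "\<lambda>t. p' t * cis (r * t) + \<i> * of_real r * (p t * cis (r * t))"
      have "(?f' has_integral (p b * cis (r * b) - p a * cis (r * a))) {a..b}"
        by (rule fundamental_theorem_of_calculus[OF True])
          (auto intro!: derivative_eq_intros has_vector_derivative_cis
              has_vector_derivative_at_within[OF p'(2)])
      moreover have "((\<lambda>t. p' t * cis (r * t)) has_integral integral {a..b} (\<lambda>t. p' t * cis (r * t))) {a..b}"
        by (intro integrable_integral integrable_continuous_real continuous_intros cp cc)
      moreover have "((\<lambda>t. \<i> * of_real r * (p t * cis (r * t))) has_integral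
          \<i> * of_real r * integral {a..b} (\<lambda>t. p t * cis (r * t))) {a..b}"
        by (intro has_integral_mult_right integrable_integral integrable_continuous_real continuous_intros cp cc)
      ultimately have "p b * cis (r * b) - p a * cis (r * a)
          = integral {a..b} (\<lambda>t. p' t * cis (r * t)) + \<i> * of_real r * integral {a..b} (\<lambda>t. p t * cis (r * t))"
        using has_integral_add has_integral_unique by blast
      then have "\<i> * of_real r * integral {a..b} (\<lambda>t. p t * cis (r * t))
          = p b * cis (r * b) - p a * cis (r * a) - integral {a..b} (\<lambda>t. p' t * cis (r * t))"
        by (simp add: algebra_simps)
      from arg_cong[where f = norm, OF this]
      have "\<bar>r\<bar> * norm (integral {a..b} (\<lambda>t. p t * cis (r * t)))
          = norm (p b * cis (r * b) - p a * cis (r * a) - integral {a..b} (\<lambda>t. p' t * cis (r * t)))"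
        by (simp only: norm_mult norm_ii norm_of_real mult_1)
      also have "\<dots> \<le> norm (p b) + norm (p a) + norm (integral {a..b} (\<lambda>t. p' t * cis (r * t)))"
        by (intro order_trans[OF norm_triangle_ineq4] add_right_mono)
          (simp add: order_trans[OF norm_triangle_ineq4] norm_mult)
      also have "norm (integral {a..b} (\<lambda>t. p' t * cis (r * t))) \<le> B * (b - a)"
        by (rule integral_bound[OF True]) (auto intro!: continuous_intros cp cc simp: norm_mult B)
      finally show ?thesis by (simp add: K_def)
    qed
    have "K \<ge> 0" using bound[of 0] by simp
    \<comment> \<open>With \<open>K + 1\<close> in place of \<open>K\<close> the threshold is
      positive, so \<open>r\<close> is nonzero, and the estimate
      \<open>K / \<bar>r\<bar> < e / 2\<close> is strict.\<close>
    have "\<forall>\<^sub>F r in at_infinity. norm (r::real) \<ge> 2 * (K + 1) / e"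
      by (auto simp: eventually_at_infinity)
    then show "\<forall>\<^sub>F r in at_infinity. dist (integral {a..b} (\<lambda>t. g t * cis (r * t))) 0 < e"
    proof eventually_elim
      case (elim r)
      have "2 * (K + 1) / e > 0" using e \<open>K \<ge> 0\<close> by simp
      with elim have r: "\<bar>r\<bar> > 0" by simp
      have "norm (integral {a..b} (\<lambda>t. p t * cis (r * t))) \<le> K / \<bar>r\<bar>"
        using bound[of r] r by (simp add: field_simps)
      also have "\<dots> < e / 2"
        using elim r e by (simp add: field_simps)
      finally have 1: "norm (integral {a..b} (\<lambda>t. p t * cis (r * t))) < e / 2" .
      have "norm (integral {a..b} (\<lambda>t. (g t - p t) * cis (r * t))) \<le> e' * (b - a)"
        by (rule integral_bound[OF True])
          (auto intro!: continuous_intros cp cc g less_imp_le[OF p(2)] simp: norm_mult)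
      also have "\<dots> \<le> e / 2"
        using True e by (simp add: e'_def field_simps)
      finally have 2: "norm (integral {a..b} (\<lambda>t. (g t - p t) * cis (r * t))) \<le> e / 2" .
      have "integral {a..b} (\<lambda>t. g t * cis (r * t))
          = integral {a..b} (\<lambda>t. (g t - p t) * cis (r * t)) + integral {a..b} (\<lambda>t. p t * cis (r * t))"
        by (subst integral_add[symmetric])
          (auto intro!: integrable_continuous_real continuous_intros cp cc g simp: algebra_simps)
      also have "norm \<dots> < e / 2 + e / 2"
        by (rule le_less_trans[OF norm_triangle_ineq add_le_less_mono[OF 2 1]])
      finally show ?case by simp
    qed
  qed
qed simp

lemma integral_cis_period:
  fixes n :: int
  assumes "T > 0"
  shows "integral {0..T} (\<lambda>t. cis (of_int n * (2 * pi / T) * (t - d))) = (if n = 0 then of_real T else 0)"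
proof (cases "n = 0")
  case True
  then show ?thesis using assms by (simp add: scaleR_conv_of_real)
next
  case False
  define r where "r = of_int n * (2 * pi / T)"
  have r: "r \<noteq> 0" using False assms by (simp add: r_def)
  have "((\<lambda>t. cis (r * (t - d))) has_integral
      (cis (r * T) * cis (- r * d) / (\<i> * r) - cis (r * 0) * cis (- r * d) / (\<i> * r))) {0..T}"
  proof (rule fundamental_theorem_of_calculus)
    fix t
    have "((\<lambda>t. cis (r * t) * (cis (- r * d) / (\<i> * r))) has_vector_derivative
        (\<i> * r * cis (r * t)) * (cis (- r * d) / (\<i> * r))) (at t within {0..T})"
      by (intro has_vector_derivative_mult_left has_vector_derivative_cis)
    moreover have "(\<i> * r * cis (r * t)) * (cis (- r * d) / (\<i> * r)) = cis (r * (t - d))"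
      using r by (simp add: cis_mult algebra_simps)
    ultimately show "((\<lambda>t. cis (r * t) * cis (- r * d) / (\<i> * r)) has_vector_derivative
        cis (r * (t - d))) (at t within {0..T})" by simp
  qed (use assms in simp)
  moreover have "cis (r * T) = 1"
    using assms cis_multiple_2pi[of "of_int n"] by (simp add: r_def mult_ac)
  ultimately show ?thesis using False by (simp add: r_def integral_unique)
qed

lemma sum_telescope_symmetric:
  fixes A :: "int \<Rightarrow> 'a::ab_group_add"
  shows "(\<Sum>n = - int N..int N. A (n - 1) - A n) = A (- int N - 1) - A (int N)"
proof (induction N)
  case (Suc N)
  have "{- int (Suc N)..int (Suc N)} = insert (- int (Suc N)) (insert (int (Suc N)) {- int N..int N})"
    by auto
  then show ?case using Suc by (simp add: minus_diff_commute)
qed simp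

text \<open>
  Chernoff's argument: dividing \<open>f t - f d\<close> by \<open>cis (\<omega> (t - d)) - 1\<close> leaves a continuous function, and
  the multiplication by this factor turns the Fourier series at \<open>d\<close> into a telescoping one.
\<close>

theorem Fourier_series_at_differentiable_point:
  fixes f :: "real \<Rightarrow> complex"
  assumes T: "T > 0" and d: "0 < d" "d < T"
    and f: "continuous_on {0..T} f" and f': "(f has_vector_derivative f') (at d)"
    and \<omega>: "\<omega> = 2 * pi / T"
  shows "(\<lambda>N. \<Sum>n = - int N..int N.
    cis (of_int n * \<omega> * d) * (integral {0..T} (\<lambda>t. f t * cis (- (of_int n * \<omega>) * t)) / T)) \<longlonglongrightarrow> f d"
proof -
  have \<omega>0: "\<omega> > 0" using T by (simp add: \<omega>)
  define k where "k t = cis (\<omega> * (t - d)) - 1" for t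
  have k: "(k has_vector_derivative \<i> * \<omega>) (at d)"
  proof -
    have "k = (\<lambda>t. cis (\<omega> * t) * cis (- \<omega> * d) - 1)"
      by (auto simp: k_def cis_mult algebra_simps)
    moreover have "((\<lambda>t. cis (\<omega> * t) * cis (- \<omega> * d) - 1) has_vector_derivative
       (\<i> * \<omega> * cis (\<omega> * d)) * cis (- \<omega> * d) - 0) (at d)"
      by (intro derivative_intros has_vector_derivative_mult_left has_vector_derivative_cis)
    ultimately show ?thesis by (simp add: cis_mult mult.assoc)
  qed
  have k0: "k t \<noteq> 0" if "t \<in> {0..T}" "t \<noteq> d" for t
  proof
    assume "k t = 0"
    then have "cos (\<omega> * (t - d)) = 1" by (simp add: k_def complex_eq_iff)
    then obtain n :: int where n: "\<omega> * (t - d) = of_int n * 2 * pi"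
      using cos_one_2pi_int by (metis mult.assoc)
    then have td: "t - d = of_int n * T" using T pi_gt_zero unfolding \<omega> by (simp add: divide_eq_eq)
    \<comment> \<open>As \<open>d\<close> is an interior point, it has distance less than
      \<open>T\<close> from every point of the interval, endpoints included. Hence \<open>d\<close>
      is the only zero of \<open>k\<close> there.\<close>
    have "\<bar>of_int n * T\<bar> < 1 * T" using that d unfolding td[symmetric] by auto
    then have "\<bar>n\<bar> < 1" using T by (simp add: abs_mult)
    then show False using td that by simp
  qed
  \<comment> \<open>The value at \<open>d\<close> is the ratio of the derivatives of
    \<open>f\<close> and \<open>k\<close>, which is the limit of the quotient and makes
    \<open>q\<close> continuous.\<close>
  define q where "q t = (if t = d then f' / (\<i> * \<omega>) else (f t - f d) / k t)" for t
  have fq: "f t = f d + q t * k t" if "t \<in> {0..T}" for t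
    using k0[OF that] by (auto simp: q_def k_def)
  have ck: "continuous_on S k" for S
    unfolding k_def by (intro continuous_intros)
  have q: "continuous_on {0..T} q"
  proof -
    have "isCont q d"
    proof -
      have quot: "((\<lambda>t. (g t - g d) / of_real (t - d)) \<longlongrightarrow> g') (at d)"
        if "(g has_vector_derivative g') (at d)" for g :: "real \<Rightarrow> complex" and g'
      proof -
        have "((\<lambda>t. norm (g t - g d - (t - d) *\<^sub>R g') / norm (t - d)) \<longlongrightarrow> 0) (at d)"
          using that unfolding has_vector_derivative_def has_derivative_iff_norm by simp
        moreover have "\<forall>\<^sub>F t in at d. norm (g t - g d - (t - d) *\<^sub>R g') / norm (t - d)
            = norm ((g t - g d) / of_real (t - d) - g')"
        proof (rule eventually_at_filter[THEN iffD2], intro always_eventually allI impI)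
          fix t assume "t \<noteq> d"
          then have "(g t - g d) / of_real (t - d) - g' = (g t - g d - (t - d) *\<^sub>R g') / of_real (t - d)"
            by (simp add: diff_divide_distrib scaleR_conv_of_real del: of_real_diff)
          then show "norm (g t - g d - (t - d) *\<^sub>R g') / norm (t - d)
            = norm ((g t - g d) / of_real (t - d) - g')"
            by (simp add: norm_divide del: of_real_diff)
        qed
        ultimately have "((\<lambda>t. norm ((g t - g d) / of_real (t - d) - g')) \<longlongrightarrow> 0) (at d)"
          by (rule Lim_transform_eventually)
        then show ?thesis
          by (simp only: tendsto_norm_zero_iff LIM_zero_iff)
      qed
      have "((\<lambda>t. ((f t - f d) / of_real (t - d)) / ((k t - k d) / of_real (t - d))) \<longlongrightarrow> f' / (\<i> * \<omega>)) (at d)"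
        using \<omega>0 by (intro tendsto_divide quot f' k) auto
      moreover have "\<forall>\<^sub>F t in at d. ((f t - f d) / of_real (t - d)) / ((k t - k d) / of_real (t - d)) = q t"
        by (auto simp: q_def k_def eventually_at_filter)
      ultimately have "(q \<longlongrightarrow> f' / (\<i> * \<omega>)) (at d)" by (rule Lim_transform_eventually)
      then show ?thesis by (simp add: isCont_def q_def)
    qed
    moreover have "continuous_on ({0..T} - {d}) q"
    proof (rule continuous_on_eq)
      show "continuous_on ({0..T} - {d}) (\<lambda>t. (f t - f d) / k t)"
        using k0 by (intro continuous_intros continuous_on_subset[OF f] ck) auto
    qed (simp add: q_def)
    moreover have "at t within {0..T} = at t within ({0..T} - {d})" if "t \<noteq> d" for t
      by (rule at_within_nhd[of _ "- {d}"]) (use that in auto)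
    ultimately show ?thesis
      unfolding continuous_on_eq_continuous_within
      using continuous_at_imp_continuous_at_within by fastforce
  qed
  define A where "A n = integral {0..T} (\<lambda>t. q t * cis (- (of_int n * \<omega>) * (t - d))) / T" for n :: int
  \<comment> \<open>In \<open>f t = f d + q t * k t\<close> the constant contributes only to the
    harmonic \<open>n = 0\<close>, while the factor \<open>cis (\<omega> * (t - d))\<close> in
    \<open>k\<close> lowers the index of the coefficient of \<open>q\<close> by one.\<close>
  have coeff: "cis (of_int n * \<omega> * d) * (integral {0..T} (\<lambda>t. f t * cis (- (of_int n * \<omega>) * t)) / T)
     = (if n = 0 then f d else 0) + (A (n - 1) - A n)" for n :: int
  proof -
    let ?c = "\<lambda>n t. cis (- (of_int n * \<omega>) * (t - d))"
    have cc: "continuous_on {0..T} (?c n)" for n by (intro continuous_intros)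
    have "integral {0..T} (\<lambda>t. f d * ?c n t + (q t * ?c (n - 1) t - q t * ?c n t))
      = f d * integral {0..T} (?c n) + (integral {0..T} (\<lambda>t. q t * ?c (n - 1) t) - integral {0..T} (\<lambda>t. q t * ?c n t))"
      by (intro integral_unique has_integral_add has_integral_diff has_integral_mult_right integrable_integral
        integrable_continuous_real continuous_intros cc q)
    also have "integral {0..T} (\<lambda>t. f d * ?c n t + (q t * ?c (n - 1) t - q t * ?c n t))
       = integral {0..T} (\<lambda>t. cis (of_int n * \<omega> * d) * (f t * cis (- (of_int n * \<omega>) * t)))"
    proof (rule integral_cong)
      fix t assume t: "t \<in> {0..T}"
      have c: "?c (n - 1) t = cis (\<omega> * (t - d)) * ?c n t"
        by (simp add: cis_mult algebra_simps)
      have "cis (of_int n * \<omega> * d) * cis (- (of_int n * \<omega>) * t) = ?c n t"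
        by (simp add: cis_mult algebra_simps)
      then have "cis (of_int n * \<omega> * d) * (f t * cis (- (of_int n * \<omega>) * t)) = f t * ?c n t"
        by (simp add: mult.left_commute[of _ "f t"])
      then show "f d * ?c n t + (q t * ?c (n - 1) t - q t * ?c n t)
        = cis (of_int n * \<omega> * d) * (f t * cis (- (of_int n * \<omega>) * t))"
        unfolding c by (simp add: fq[OF t] k_def algebra_simps)
    qed
    finally have "cis (of_int n * \<omega> * d) * integral {0..T} (\<lambda>t. f t * cis (- (of_int n * \<omega>) * t))
       = f d * integral {0..T} (?c n) + (integral {0..T} (\<lambda>t. q t * ?c (n - 1) t) - integral {0..T} (\<lambda>t. q t * ?c n t))"
      by simp
    moreover have "integral {0..T} (?c n) = (if n = 0 then T else 0)"
      using integral_cis_period[OF T, of "- n" d] by (simp add: \<omega>)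
    ultimately show ?thesis
      using T by (simp add: A_def diff_divide_distrib add_divide_distrib)
  qed
  have A: "((\<lambda>N. A (s N)) \<longlonglongrightarrow> 0)" if s: "filterlim (\<lambda>N. \<bar>real_of_int (s N)\<bar>) at_top sequentially" for s
  proof -
    have "filterlim (\<lambda>N. \<omega> * \<bar>real_of_int (s N)\<bar>) at_top sequentially"
      using filterlim_tendsto_pos_mult_at_top[OF tendsto_const \<omega>0 s] .
    then have "filterlim (\<lambda>N. - (of_int (s N) * \<omega>)) at_infinity sequentially"
      using \<omega>0 by (simp add: filterlim_at_infinity_conv_norm_at_top abs_mult mult.commute)
    from filterlim_compose[OF Riemann_Lebesgue_interval[OF q] this]
    have "(\<lambda>N. norm (integral {0..T} (\<lambda>t. q t * cis (- (of_int (s N) * \<omega>) * t))) / T) \<longlonglongrightarrow> 0"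
      using tendsto_divide_zero tendsto_norm_zero by blast
    \<comment> \<open>Measuring the phase from \<open>d\<close> instead of \<open>0\<close>
      multiplies the integral by a constant of modulus one, so the Riemann-Lebesgue limit carries
      over to \<open>A\<close>.\<close>
    moreover have "norm (A n) = norm (integral {0..T} (\<lambda>t. q t * cis (- (of_int n * \<omega>) * t))) / T" for n
    proof -
      have "(\<lambda>t. q t * cis (- (of_int n * \<omega>) * (t - d))) =
         (\<lambda>t. cis (of_int n * \<omega> * d) * (q t * cis (- (of_int n * \<omega>) * t)))"
        by (auto simp: cis_mult algebra_simps)
      then show ?thesis using T by (simp add: A_def norm_divide norm_mult)
    qed
    ultimately have "(\<lambda>N. norm (A (s N))) \<longlonglongrightarrow> 0" by simp
    then show ?thesis by (rule tendsto_norm_zero_cancel)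
  qed
  have "(\<lambda>N. A (- int N - 1)) \<longlonglongrightarrow> 0" "(\<lambda>N. A (int N)) \<longlonglongrightarrow> 0"
    using A[of "\<lambda>N. - int N - 1"] A[of "\<lambda>N. int N"]
      filterlim_at_top_mono[OF filterlim_real_sequentially, of "\<lambda>N. \<bar>real_of_int (- int N - 1)\<bar>"]
      filterlim_real_sequentially by simp_all
  then have "(\<lambda>N. f d + (A (- int N - 1) - A (int N))) \<longlonglongrightarrow> f d + (0 - 0)"
    by (intro tendsto_add tendsto_diff tendsto_const)
  moreover have "(\<Sum>n = - int N..int N.
    cis (of_int n * \<omega> * d) * (integral {0..T} (\<lambda>t. f t * cis (- (of_int n * \<omega>) * t)) / T))
     = f d + (A (- int N - 1) - A (int N))" for N
    unfolding coeff sum.distrib sum_telescope_symmetric by simp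
  ultimately show ?thesis by simp
qed

subsection \<open>Differentiability of a first zero\<close>

text \<open>Has the shape of \<open>switching_instant\<close>, including the default
  \<open>T\<close>, so that switching becomes the first zero of the gap between output and
  ramp.\<close>

definition first_zero :: "real \<Rightarrow> (real \<Rightarrow> real) \<Rightarrow> real" where
  "first_zero T g = Inf (insert T {t \<in> {0..<T}. g t = 0})"

lemma first_zero_cong:
  assumes "\<And>t. 0 \<le> t \<Longrightarrow> t < T \<Longrightarrow> f t = 0 \<longleftrightarrow> g t = 0"
  shows "first_zero T f = first_zero T g"
proof -
  have "{t \<in> {0..<T}. f t = 0} = {t \<in> {0..<T}. g t = 0}" using assms by auto
  then show ?thesis by (simp add: first_zero_def)
qed

lemma first_zero_le:
  assumes "0 \<le> t" "t < T" "g t = 0"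
  shows "first_zero T g \<le> t"
  unfolding first_zero_def
  by (rule cInf_lower) (use assms in \<open>auto intro!: bdd_belowI[of _ 0]\<close>)

lemma first_zero_ge:
  assumes "s \<le> T" "\<And>t. 0 \<le> t \<Longrightarrow> t < s \<Longrightarrow> g t \<noteq> 0"
  shows "s \<le> first_zero T g"
  unfolding first_zero_def
  by (rule cInf_greatest) (use assms in force)+

lemma first_zero_root:
  assumes T: "T > 0" and g: "continuous_on {0..T} g" and less: "first_zero T g < T"
  shows "g (first_zero T g) = 0"
proof -
  let ?Z = "{t \<in> {0..T}. g t = 0}"
  have "closed ?Z"
    using continuous_closed_preimage_constant[OF g, of 0] by simp
  \<comment> \<open>Allowing \<open>t = T\<close> does not change a set that contains
    \<open>T\<close> anyway, but now the zeros form a closed set and the infimum is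
    attained.\<close>
  moreover have eq: "first_zero T g = Inf (insert T ?Z)"
    unfolding first_zero_def by (rule arg_cong[of _ _ Inf]) auto
  ultimately have "first_zero T g \<in> insert T ?Z"
    unfolding eq by (intro closed_contains_Inf) (auto intro!: bdd_belowI[of _ 0] simp: T less_imp_le)
  then show ?thesis using less by auto
qed

context
  fixes T :: real and g :: "real \<Rightarrow> real" and a :: "real \<Rightarrow> 'a::real_inner" and x0 :: 'a
    and d g' :: real
  assumes T: "T > 0" and g: "continuous_on {0..T} g" and a: "continuous_on {0..T} a"
    and d: "d = first_zero T g" "0 < d" "d < T"
    and g': "(g has_real_derivative g') (at d)"
begin

lemma root_d: "g d = 0"
  using first_zero_root[OF T g] d by simp

text \<open>If \<open>g\<close> rises through its first zero, it is negative before \<open>d\<close>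
  and positive just after. A small perturbation neither creates a zero before
  \<open>d - \<epsilon>\<close> nor removes the sign change between \<open>d - \<epsilon>\<close>
  and \<open>d + \<epsilon>\<close>.\<close>

lemma first_zero_perturbation_tendsto:
  assumes pos: "g' > 0"
  shows "((\<lambda>x. first_zero T (\<lambda>t. g t + a t \<bullet> (x - x0))) \<longlongrightarrow> d) (at x0)"
proof (rule tendstoI)
  fix e :: real assume e: "e > 0"
  obtain e1 where e1: "e1 > 0" "\<And>h. 0 < h \<Longrightarrow> h < e1 \<Longrightarrow> 0 < g (d + h)"
    using DERIV_pos_inc_right[OF g' pos] root_d by auto
  obtain e2 where e2: "e2 > 0" "\<And>h. 0 < h \<Longrightarrow> h < e2 \<Longrightarrow> g (d - h) < 0"
    using DERIV_pos_inc_left[OF g' pos] root_d by auto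
  define \<epsilon> where "\<epsilon> = min (min e d) (min (T - d) e1) / 2"
  have \<epsilon>: "\<epsilon> > 0" "\<epsilon> < e" "\<epsilon> < d" "\<epsilon> < T - d" "\<epsilon> < e1"
    using e d(2,3) e1(1) by (auto simp: \<epsilon>_def min_def)
  \<comment> \<open>Since \<open>g\<close> is negative immediately to the left of \<open>d\<close>,
    a nonnegative earlier value would yield a zero before \<open>d\<close>.\<close>
  have neg: "g t < 0" if t: "0 \<le> t" "t < d" for t
  proof (rule ccontr)
    assume "\<not> g t < 0"
    define h where "h = min e2 (d - t) / 2"
    have h: "h > 0" "h < e2" "h < d - t" using e2(1) t by (auto simp: h_def min_def)
    then have "g (d - h) \<le> 0" using e2(2) by (simp add: less_imp_le)
    then obtain s where "t \<le> s" "s \<le> d - h" "g s = 0"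
      using IVT2'[of g "d - h" 0 t] \<open>\<not> g t < 0\<close> h continuous_on_subset[OF g, of "{t..d - h}"] t d by auto
    with t h first_zero_le[of s T g] d show False by simp
  qed
  obtain z where z: "0 \<le> z" "z \<le> d - \<epsilon>" "\<And>t. 0 \<le> t \<Longrightarrow> t \<le> d - \<epsilon> \<Longrightarrow> g t \<le> g z"
    using continuous_attains_sup[of "{0..d - \<epsilon>}" g] continuous_on_subset[OF g, of "{0..d - \<epsilon>}"] \<epsilon> d
    by auto
  have gz: "g z < 0" using neg z \<epsilon> by simp
  have gu: "g (d + \<epsilon>) > 0" using e1 \<epsilon> by simp
  obtain B where B: "B > 0" "\<And>t. t \<in> {0..T} \<Longrightarrow> norm (a t) \<le> B"
    using compact_imp_bounded[OF compact_continuous_image[OF a compact_Icc]]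
    unfolding bounded_pos by auto
  \<comment> \<open>The margin by which \<open>g\<close> is negative on
    \<open>{0..d - \<epsilon>}\<close>, where \<open>z\<close> maximizes it, and positive at
    \<open>d + \<epsilon>\<close>; perturbations below \<open>\<mu>\<close> preserve both
    signs.\<close>
  define \<mu> where "\<mu> = min (- g z) (g (d + \<epsilon>))"
  have \<mu>: "\<mu> > 0" using gz gu by (simp add: \<mu>_def)
  have "\<forall>\<^sub>F x in at x0. dist x x0 < \<mu> / B"
    using \<mu> B by (auto simp: eventually_at intro!: exI[of _ "\<mu> / B"])
  then show "\<forall>\<^sub>F x in at x0. dist (first_zero T (\<lambda>t. g t + a t \<bullet> (x - x0))) d < e"
  proof eventually_elim
    case (elim x)
    define G where "G t = g t + a t \<bullet> (x - x0)" for t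
    have cG: "continuous_on {0..T} G"
      unfolding G_def by (intro continuous_intros g a)
    have small: "\<bar>a t \<bullet> (x - x0)\<bar> < \<mu>" if "t \<in> {0..T}" for t
    proof -
      have "\<bar>a t \<bullet> (x - x0)\<bar> \<le> norm (a t) * norm (x - x0)" by (rule Cauchy_Schwarz_ineq2)
      also have "\<dots> \<le> B * norm (x - x0)" using B that by (intro mult_right_mono) auto
      also have "\<dots> < \<mu>" using elim B by (simp add: dist_norm field_simps)
      finally show ?thesis .
    qed
    have G1: "G t < 0" if "0 \<le> t" "t \<le> d - \<epsilon>" for t
      using small[of t] z(3)[OF that] that \<epsilon> d(2,3) abs_ge_self[of "a t \<bullet> (x - x0)"]
      by (simp add: G_def \<mu>_def del: abs_ge_self)
    have G2: "G (d + \<epsilon>) > 0"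
      using small[of "d + \<epsilon>"] \<epsilon> d(2,3) abs_ge_minus_self[of "a (d + \<epsilon>) \<bullet> (x - x0)"]
      by (simp add: G_def \<mu>_def del: abs_ge_minus_self)
    have "d - \<epsilon> \<le> first_zero T G"
    proof (rule first_zero_ge)
      show "d - \<epsilon> \<le> T" using \<epsilon> d(3) by simp
      show "G t \<noteq> 0" if "0 \<le> t" "t < d - \<epsilon>" for t using G1[of t] that by simp
    qed
    moreover obtain c where "d - \<epsilon> \<le> c" "c \<le> d + \<epsilon>" "G c = 0"
      using IVT'[of G "d - \<epsilon>" 0 "d + \<epsilon>"] G1[of "d - \<epsilon>"] G2 \<epsilon>
        continuous_on_subset[OF cG, of "{d - \<epsilon>..d + \<epsilon>}"] d by auto
    then have "first_zero T G \<le> d + \<epsilon>"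
      using first_zero_le[of c T G] \<epsilon> by simp
    ultimately have "dist (first_zero T G) d < e"
      using \<epsilon> by (simp add: dist_real_def)
    then show ?case by (simp add: G_def[abs_def])
  qed
qed

end

text \<open>With the Caratheodory factor \<open>q\<close> of \<open>g\<close> at \<open>d\<close>,
  the equation for the perturbed zero \<open>\<delta> x\<close> can be solved exactly for
  \<open>\<delta> x - d\<close>, as the inner product of \<open>x - x0\<close> with minus
  \<open>a (\<delta> x) /\<^sub>R q (\<delta> x)\<close>. Because \<open>\<delta> x\<close> tends to
  \<open>d\<close>, this vector converges to the gradient.\<close>

lemma first_zero_perturbation_has_derivative:
  fixes a :: "real \<Rightarrow> 'a::real_inner"
  assumes T: "T > 0" and g: "continuous_on {0..T} g" and a: "continuous_on {0..T} a"
    and d: "d = first_zero T g" "0 < d" "d < T"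
    and g': "(g has_real_derivative g') (at d)" and "g' \<noteq> 0"
  shows "((\<lambda>x. first_zero T (\<lambda>t. g t + a t \<bullet> (x - x0))) has_derivative
    (\<lambda>v. - (a d \<bullet> v) / g')) (at x0)"
proof -
  define \<delta> where "\<delta> x = first_zero T (\<lambda>t. g t + a t \<bullet> (x - x0))" for x
  have lim: "(\<delta> \<longlongrightarrow> d) (at x0)"
  proof (cases "g' > 0")
    case True
    then show ?thesis unfolding \<delta>_def
      using first_zero_perturbation_tendsto[OF T g a d g'] by blast
  next
    \<comment> \<open>Changing the signs of \<open>g\<close> and \<open>a\<close> keeps all zeros
      and turns a falling crossing into a rising one.\<close>
    case False
    have "first_zero T (\<lambda>t. - g t) = first_zero T g" by (rule first_zero_cong) simp
    then have "((\<lambda>x. first_zero T (\<lambda>t. - g t + - a t \<bullet> (x - x0))) \<longlongrightarrow> d) (at x0)"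
      using False \<open>g' \<noteq> 0\<close>
      by (intro first_zero_perturbation_tendsto[of _ _ _ _ "- g'"])
        (auto intro!: continuous_intros derivative_intros T g a d g')
    moreover have "first_zero T (\<lambda>t. - g t + - a t \<bullet> (x - x0)) = \<delta> x" for x
      unfolding \<delta>_def by (rule first_zero_cong) (auto simp: algebra_simps)
    ultimately show ?thesis by simp
  qed
  have \<delta>0: "\<delta> x0 = d" by (simp add: \<delta>_def d)
  obtain q where q: "\<And>t. g t - g d = q t * (t - d)" "isCont q d" "q d = g'"
    using g' unfolding CARAT_DERIV by blast
  have gd: "g d = 0" using first_zero_root[OF T g] d by simp
  have "isCont a d"
    using a d by (intro continuous_on_interior[OF a]) simp
  then have w: "((\<lambda>x. a (\<delta> x) /\<^sub>R q (\<delta> x)) \<longlongrightarrow> a d /\<^sub>R g') (at x0)"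
    using q \<open>g' \<noteq> 0\<close> isCont_tendsto_compose[OF q(2) lim] isCont_tendsto_compose[OF _ lim, of a]
    by (auto intro!: tendsto_intros)
  have "((\<lambda>x. q (\<delta> x)) \<longlongrightarrow> g') (at x0)"
    using isCont_tendsto_compose[OF q(2) lim] q(3) by simp
  then have "\<forall>\<^sub>F x in at x0. q (\<delta> x) \<noteq> 0"
    using \<open>g' \<noteq> 0\<close> by (rule tendsto_imp_eventually_ne)
  \<comment> \<open>Values below \<open>T\<close> are true zeros and not the default of
    \<open>first_zero\<close>.\<close>
  moreover have "\<forall>\<^sub>F x in at x0. \<delta> x < T" using lim d(3) by (rule order_tendstoD)
  ultimately have ev: "\<forall>\<^sub>F x in at x0.
    norm (norm (\<delta> x - \<delta> x0 - - (a d \<bullet> (x - x0)) / g') / norm (x - x0))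
      \<le> norm (a (\<delta> x) /\<^sub>R q (\<delta> x) - a d /\<^sub>R g')"
  proof eventually_elim
    case (elim x)
    have "g (\<delta> x) + a (\<delta> x) \<bullet> (x - x0) = 0"
      unfolding \<delta>_def
      by (rule first_zero_root[OF T]) (use elim(2) in \<open>auto simp: \<delta>_def intro!: continuous_intros g a\<close>)
    then have "q (\<delta> x) * (\<delta> x - d) = - (a (\<delta> x) \<bullet> (x - x0))"
      using q(1)[of "\<delta> x"] gd by simp
    then have "\<delta> x - d = - ((a (\<delta> x) /\<^sub>R q (\<delta> x)) \<bullet> (x - x0))"
      using elim(1) by (simp add: field_simps)
    then have "\<delta> x - \<delta> x0 - - (a d \<bullet> (x - x0)) / g'
        = - ((a (\<delta> x) /\<^sub>R q (\<delta> x) - a d /\<^sub>R g') \<bullet> (x - x0))"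
      by (simp add: \<delta>0 inner_diff_left field_simps)
    then have "norm (\<delta> x - \<delta> x0 - - (a d \<bullet> (x - x0)) / g')
        \<le> norm (a (\<delta> x) /\<^sub>R q (\<delta> x) - a d /\<^sub>R g') * norm (x - x0)"
      using Cauchy_Schwarz_ineq2 by simp
    then show ?case
      by (cases "x = x0") (simp_all add: divide_le_eq)
  qed
  have "((\<lambda>x. norm (a (\<delta> x) /\<^sub>R q (\<delta> x) - a d /\<^sub>R g')) \<longlongrightarrow> 0) (at x0)"
    using w by (simp add: tendsto_norm_zero_iff LIM_zero_iff)
  then have "((\<lambda>x. norm (\<delta> x - \<delta> x0 - - (a d \<bullet> (x - x0)) / g') / norm (x - x0)) \<longlongrightarrow> 0) (at x0)"
    by (rule Lim_null_comparison[OF ev])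
  moreover have "bounded_linear (\<lambda>v. - (a d \<bullet> v) / g')"
    using bounded_linear_const_mult[OF bounded_linear_inner_right, of "- inverse g'" "a d"]
    by (simp add: divide_inverse mult.commute)
  ultimately have "(\<delta> has_derivative (\<lambda>v. - (a d \<bullet> v) / g')) (at x0)"
    by (simp add: has_derivative_iff_norm)
  then show ?thesis by (simp add: \<delta>_def[abs_def])
qed

subsection \<open>Switched affine converters\<close>

lemma ramp_eq:
  assumes "0 \<le> t" "t < Ts"
  shows "ramp Vl Vh Ts t = Vl + Vh * t / Ts"
proof -
  have "frac (t / Ts) = t / Ts"
    using assms by (subst frac_eq) (simp add: divide_less_eq)
  then show ?thesis by (simp add: ramp_def)
qed

lemma deriv_ramp:
  assumes "0 < d" "d < Ts"
  shows "deriv (ramp Vl Vh Ts) d = Vh / Ts"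
proof (rule DERIV_imp_deriv)
  have "((\<lambda>t. Vl + Vh * t / Ts) has_real_derivative Vh / Ts) (at d)"
    using assms by (auto intro!: derivative_eq_intros)
  then show "(ramp Vl Vh Ts has_real_derivative Vh / Ts) (at d)"
    by (rule has_field_derivative_transform_within_open[of _ _ _ "{0<..<Ts}"])
      (use assms in \<open>auto simp: ramp_eq\<close>)
qed

text \<open>The form shared by all three control schemes: \<open>\<beta>\<close> is the direction in
  which the switched voltage enters, \<open>r\<close> and \<open>\<kappa>\<close> collect the
  constant sources.\<close>

locale switched_affine_converter =
  fixes S :: "'s::euclidean_space converter" and M :: "'s \<Rightarrow> 's" and \<beta> r :: 's
    and K :: "'s \<Rightarrow> real" and \<kappa> Ts vs Vl Vh :: real
  assumes M: "linear M" and K: "linear K"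
    and vfield: "vfield S = (\<lambda>v x. M x + (v *\<^sub>R \<beta> + r))"
    and comp_output: "comp_output S = (\<lambda>x. K x + \<kappa>)"
    and Ts: "Ts > 0" and Vh: "Vh > 0" and vs: "vs > 0"
begin

abbreviation E :: "real \<Rightarrow> 's \<Rightarrow> 's" where "E \<equiv> linear_flow M"
abbreviation F :: "real \<Rightarrow> 's \<Rightarrow> 's" where "F \<equiv> vfield S"
abbreviation h :: "real \<Rightarrow> real" where "h \<equiv> ramp Vl Vh Ts"

lemma F: "F v x = M x + (v *\<^sub>R \<beta> + r)" by (simp add: vfield)

lemmas flow_deriv = affine_flow_deriv[OF M F]
  and flow_shift = affine_flow_shift[OF M F]
  and flow_field = affine_flow_field[OF M F]

lemmas lin = linear_linear_flow[OF M]

lemma E_commute: "E s (E t x) = E t (E s x)"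
  using linear_flow_add[OF M, of s t x] linear_flow_add[OF M, of t s x] by (simp add: add.commute)

text \<open>The functional \<open>\<lambda>v. K (E t v)\<close> represented by a vector, to fit the
  inner product in the lemmas on \<open>first_zero\<close>.\<close>

definition row :: "real \<Rightarrow> 's" where
  "row t = (\<Sum>b\<in>Basis. K (E t b) *\<^sub>R b)"

lemma row_inner: "row t \<bullet> v = K (E t v)"
proof -
  have "K (E t v) = K (E t (\<Sum>b\<in>Basis. (v \<bullet> b) *\<^sub>R b))" by (simp add: euclidean_representation)
  also have "\<dots> = (\<Sum>b\<in>Basis. (v \<bullet> b) * K (E t b))"
    by (simp add: linear_sum[OF lin] linear_scale[OF lin] linear_sum[OF K] linear_scale[OF K])
  finally show ?thesis by (simp add: row_def inner_sum_left inner_commute[of v] mult.commute)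
qed

lemma continuous_on_row: "continuous_on X row"
  unfolding row_def
  by (intro continuous_intros continuous_on_compose2[OF linear_continuous_on continuous_on_linear_flow[OF M]])
    (use K in \<open>auto simp: linear_conv_bounded_linear\<close>)

lemma switching_instant_perturbation:
  "switching_instant S h Ts vs x' =
    first_zero Ts (\<lambda>t. (K (flow (F vs) x t) + \<kappa> - (Vl + Vh * t / Ts)) + row t \<bullet> (x' - x))"
proof -
  have "comp_output S (flow (F vs) x' t) = h t \<longleftrightarrow>
    (K (flow (F vs) x t) + \<kappa> - (Vl + Vh * t / Ts)) + row t \<bullet> (x' - x) = 0"
    if "t \<in> {0..<Ts}" for t
    using that flow_shift[of vs x' t x]
    by (auto simp: comp_output row_inner linear_add[OF K] ramp_eq)
  then have "{t \<in> {0..<Ts}. comp_output S (flow (F vs) x' t) = h t} = {t \<in> {0..<Ts}.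
    (K (flow (F vs) x t) + \<kappa> - (Vl + Vh * t / Ts)) + row t \<bullet> (x' - x) = 0}"
    by blast
  then show ?thesis by (simp only: switching_instant_def first_zero_def)
qed

text \<open>Because \<open>E (Ts - \<tau>)\<close> after \<open>E \<tau>\<close> is
  \<open>E Ts\<close>, the state perturbation adds a term free of \<open>\<tau>\<close>, and the
  rest depends on \<open>x'\<close> through \<open>\<tau>\<close> alone. The Jacobian thus needs
  only a chain rule in one real variable.\<close>

lemma sampled_data_map_decomposition:
  assumes "\<tau> = switching_instant S h Ts vs x'"
  shows "sampled_data_map S h Ts vs x' =
    flow (F 0) 0 (Ts - \<tau>) + E (Ts - \<tau>) (flow (F vs) x \<tau>) + E Ts (x' - x)"
proof -
  have "sampled_data_map S h Ts vs x' = flow (F 0) (flow (F vs) x' \<tau>) (Ts - \<tau>)"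
    by (simp add: sampled_data_map_def Let_def assms)
  also have "\<dots> = flow (F 0) 0 (Ts - \<tau>) + E (Ts - \<tau>) (flow (F vs) x \<tau> + E \<tau> (x' - x))"
    using flow_shift[of 0 "flow (F vs) x' \<tau>" "Ts - \<tau>" 0] flow_shift[of vs x' \<tau> x] by simp
  also have "E (Ts - \<tau>) (flow (F vs) x \<tau> + E \<tau> (x' - x)) = E (Ts - \<tau>) (flow (F vs) x \<tau>) + E Ts (x' - x)"
    using linear_flow_add[OF M, of "Ts - \<tau>" \<tau> "x' - x"] by (simp add: linear_add[OF lin])
  finally show ?thesis by simp
qed

section \<open>Jacobian of the sampled-data map\<close>

definition gap_slope :: "'s \<Rightarrow> real \<Rightarrow> real" where
  "gap_slope x d = K (F vs (flow (F vs) x d)) - Vh / Ts"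

lemma output_deriv:
  "((\<lambda>t. K (flow (F vs) x t)) has_real_derivative K (F vs (flow (F vs) x t))) (at t)"
  unfolding has_real_derivative_iff_has_vector_derivative
  using bounded_linear.has_vector_derivative[OF _ flow_deriv] K
  by (simp add: linear_conv_bounded_linear)

lemma transversal_switching_gap_slope:
  assumes "transversal_switching S h Ts vs x" "switching_instant S h Ts vs x = d" "0 < d" "d < Ts"
  shows "gap_slope x d \<noteq> 0"
proof -
  have "((\<lambda>t. comp_output S (flow (F vs) x t)) has_real_derivative K (F vs (flow (F vs) x d))) (at d)"
    unfolding comp_output by (rule derivative_eq_intros output_deriv refl)+ simp
  then show ?thesis
    using assms by (simp add: transversal_switching_def Let_def DERIV_imp_deriv deriv_ramp gap_slope_def)
qed

lemma sampled_data_map_has_derivative: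
  assumes d: "switching_instant S h Ts vs x = d" "0 < d" "d < Ts" and slope: "gap_slope x d \<noteq> 0"
  shows "(sampled_data_map S h Ts vs has_derivative
    (\<lambda>v. E Ts v - (K (E d v) / gap_slope x d * vs) *\<^sub>R E (Ts - d) \<beta>)) (at x)"
proof -
  define g where "g t = K (flow (F vs) x t) + \<kappa> - (Vl + Vh * t / Ts)" for t
  have g': "(g has_real_derivative K (F vs (flow (F vs) x t)) - Vh / Ts) (at t)" for t
    unfolding g_def using Ts by (auto intro!: derivative_eq_intros output_deriv)
  then have "continuous_on {0..Ts} g"
    by (intro continuous_at_imp_continuous_on ballI DERIV_isCont)
  moreover have "d = first_zero Ts g"
    using switching_instant_perturbation[of x x] d by (simp add: g_def[abs_def])
  ultimately have \<delta>: "(switching_instant S h Ts vs has_derivative (\<lambda>v. - (K (E d v)) / gap_slope x d)) (at x)"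
    using first_zero_perturbation_has_derivative[OF Ts _ continuous_on_row _ d(2,3), of g "gap_slope x d" x]
      g'[of d] slope
    unfolding switching_instant_perturbation[abs_def, of x] g_def[symmetric] gap_slope_def[symmetric] row_inner
    by simp
  define Q where "Q \<tau> = flow (F 0) 0 (Ts - \<tau>) + E (Ts - \<tau>) (flow (F vs) x \<tau>)" for \<tau>
  have "(Q has_vector_derivative vs *\<^sub>R E (Ts - \<tau>) \<beta>) (at \<tau>)" for \<tau>
  proof -
    have s: "((\<lambda>\<tau>. Ts - \<tau>) has_real_derivative -1) (at \<tau>)"
      by (auto intro!: derivative_eq_intros)
    have "((\<lambda>\<tau>. flow (F 0) 0 (Ts - \<tau>)) has_vector_derivative (-1) *\<^sub>R F 0 (flow (F 0) 0 (Ts - \<tau>))) (at \<tau>)"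
      using vector_diff_chain_at[OF s[unfolded has_real_derivative_iff_has_vector_derivative] flow_deriv]
      by (simp add: o_def)
    then have 1: "((\<lambda>\<tau>. flow (F 0) 0 (Ts - \<tau>)) has_vector_derivative - E (Ts - \<tau>) (F 0 0)) (at \<tau>)"
      by (simp add: flow_field)
    have 2: "((\<lambda>\<tau>. E (Ts - \<tau>) (flow (F vs) x \<tau>)) has_vector_derivative
      E (Ts - \<tau>) ((-1) *\<^sub>R M (flow (F vs) x \<tau>) + F vs (flow (F vs) x \<tau>))) (at \<tau>)"
      by (rule linear_flow_deriv_compose[OF M s flow_deriv])
    \<comment> \<open>\<open>M\<close> cancels here and the sources \<open>F 0 0\<close> cancel in
      the sum below. What remains is the jump \<open>vs *\<^sub>R \<beta>\<close> of the field at
      switching, transported to the end of the period.\<close>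
    have "(-1) *\<^sub>R M (flow (F vs) x \<tau>) + F vs (flow (F vs) x \<tau>) = vs *\<^sub>R \<beta> + F 0 0"
      by (simp add: F linear_0[OF M])
    then have "- E (Ts - \<tau>) (F 0 0) + E (Ts - \<tau>) ((-1) *\<^sub>R M (flow (F vs) x \<tau>) + F vs (flow (F vs) x \<tau>))
      = vs *\<^sub>R E (Ts - \<tau>) \<beta>"
      by (simp add: linear_add[OF lin] linear_scale[OF lin])
    with has_vector_derivative_add[OF 1 2] show ?thesis unfolding Q_def by simp
  qed
  then have "(Q has_derivative (\<lambda>s. s *\<^sub>R (vs *\<^sub>R E (Ts - d) \<beta>))) (at (switching_instant S h Ts vs x))"
    using d by (simp add: has_vector_derivative_def)
  from has_derivative_compose[OF \<delta> this]
  have 1: "((\<lambda>x'. Q (switching_instant S h Ts vs x')) has_derivative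
    (\<lambda>v. (- K (E d v) / gap_slope x d) *\<^sub>R (vs *\<^sub>R E (Ts - d) \<beta>))) (at x)" .
  have 2: "((\<lambda>x'. E Ts (x' - x)) has_derivative (\<lambda>v. E Ts v)) (at x)"
  proof -
    have "bounded_linear (E Ts)" using lin by (simp add: linear_conv_bounded_linear)
    moreover have "((\<lambda>x'. x' - x) has_derivative (\<lambda>v. v)) (at x)"
      by (auto intro!: derivative_eq_intros)
    ultimately show ?thesis by (rule bounded_linear.has_derivative)
  qed
  have "sampled_data_map S h Ts vs = (\<lambda>x'. Q (switching_instant S h Ts vs x') + E Ts (x' - x))"
    by (auto simp: sampled_data_map_decomposition[OF refl, of _ x] Q_def)
  then show ?thesis
    using has_derivative_add[OF 1 2] by (simp add: add.commute)
qed

section \<open>The eigenvalue one of the Jacobian\<close>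

lemma steady_state_saddle_node_iff:
  assumes steady: "periodic_steady_state S h Ts vs D x"
    and trans: "transversal_switching S h Ts vs x"
    and D: "0 < D" "D < 1"
    and no_periodic: "\<And>v. E Ts v = v \<Longrightarrow> v = 0"
    and u: "u - E Ts u = \<beta>"
  shows "saddle_node_bifurcation (sampled_data_map S h Ts vs) x \<longleftrightarrow> vs * K (E (D * Ts) u) = Vh / Ts"
proof -
  define d where "d = D * Ts"
  have d: "0 < d" "d < Ts" using D Ts by (simp_all add: d_def)
  have sw: "switching_instant S h Ts vs x = d"
    using steady by (simp add: periodic_steady_state_def d_def)
  define \<gamma> where "\<gamma> = gap_slope x d"
  have \<gamma>0: "\<gamma> \<noteq> 0" using transversal_switching_gap_slope[OF trans sw d] by (simp add: \<gamma>_def)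
  define J where "J v = E Ts v - (K (E d v) / \<gamma> * vs) *\<^sub>R E (Ts - d) \<beta>" for v
  have J: "(sampled_data_map S h Ts vs has_derivative J) (at x)"
    using sampled_data_map_has_derivative[OF sw d] \<gamma>0 by (simp add: J_def[abs_def] \<gamma>_def)
  have inj: "v = w" if "v - E Ts v = w - E Ts w" for v w
    using no_periodic[of "v - w"] that by (simp add: linear_diff[OF lin] algebra_simps)
  have E\<beta>: "E t \<beta> = E t u - E Ts (E t u)" for t
    using u by (simp add: linear_diff[OF lin] E_commute[of Ts] flip: u)
  define w where "w = F vs (flow (F vs) x d)"
  \<comment> \<open>The velocity drops by \<open>vs *\<^sub>R \<beta>\<close> at \<open>d\<close>,
    rises by the same amount at the end of the period, and is carried by \<open>E\<close> in
    between. Following it once around the periodic solution gives a linear equation for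
    \<open>w\<close>, which \<open>u\<close> solves.\<close>
  have w: "w = vs *\<^sub>R (E d u - E Ts u)"
  proof (rule inj)
    let ?z = "flow (F vs) x d"
    have x: "flow (F 0) ?z (Ts - d) = x"
      using steady unfolding periodic_steady_state_def sampled_data_map_def Let_def sw
      by (rule conjunct1)
    have "F vs x = E (Ts - d) (F 0 ?z) + vs *\<^sub>R \<beta>"
      using flow_field[of 0 ?z "Ts - d"] unfolding x by (simp add: F)
    also have "F 0 ?z = w - vs *\<^sub>R \<beta>" by (simp add: w_def F)
    finally have "w = E d (E (Ts - d) (w - vs *\<^sub>R \<beta>) + vs *\<^sub>R \<beta>)"
      by (simp add: w_def flow_field)
    also have "\<dots> = E Ts w - vs *\<^sub>R E Ts \<beta> + vs *\<^sub>R E d \<beta>"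
      using linear_flow_add[OF M, of d "Ts - d" "w - vs *\<^sub>R \<beta>"]
      by (simp add: linear_add[OF lin] linear_diff[OF lin] linear_scale[OF lin])
    finally have "w - E Ts w = vs *\<^sub>R (E d \<beta> - E Ts \<beta>)" by (simp add: algebra_simps)
    then show "w - E Ts w = vs *\<^sub>R (E d u - E Ts u) - E Ts (vs *\<^sub>R (E d u - E Ts u))"
      by (simp add: E\<beta> linear_diff[OF lin] linear_scale[OF lin] algebra_simps)
  qed
  have \<gamma>: "\<gamma> = vs * K (E d u) - vs * K (E Ts u) - Vh / Ts"
    unfolding \<gamma>_def gap_slope_def w_def[symmetric]
    by (subst w) (simp add: linear_scale[OF K] linear_diff[OF K] right_diff_distrib)
  \<comment> \<open>\<open>v0 - E Ts v0\<close> equals \<open>E (Ts - d) \<beta>\<close>, so by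
    \<open>inj\<close> every fixed vector of \<open>J\<close> is a multiple of
    \<open>v0\<close>.\<close>
  define v0 where "v0 = E (Ts - d) u"
  have Kv0: "K (E d v0) = K (E Ts u)"
    using linear_flow_add[OF M, of d "Ts - d" u] by (simp add: v0_def)
  have fix_iff: "J v = v \<longleftrightarrow> v = (- (K (E d v) / \<gamma> * vs)) *\<^sub>R v0" for v
  proof -
    define s where "s = - (K (E d v) / \<gamma> * vs)"
    have "J v = v \<longleftrightarrow> v - E Ts v = s *\<^sub>R E (Ts - d) \<beta>"
      by (auto simp: J_def s_def algebra_simps)
    also have "\<dots> \<longleftrightarrow> v - E Ts v = s *\<^sub>R v0 - E Ts (s *\<^sub>R v0)"
      by (simp add: E\<beta> v0_def linear_scale[OF lin] scaleR_diff_right)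
    also have "\<dots> \<longleftrightarrow> v = s *\<^sub>R v0" using inj by blast
    finally show ?thesis by (simp add: s_def)
  qed
  have "saddle_node_bifurcation (sampled_data_map S h Ts vs) x \<longleftrightarrow> (\<exists>v. v \<noteq> 0 \<and> J v = v)"
    unfolding saddle_node_bifurcation_def scaleR_one using J has_derivative_unique[OF J] by blast
  also have "\<dots> \<longleftrightarrow> \<gamma> = - vs * K (E Ts u)"
  proof
    assume "\<exists>v. v \<noteq> 0 \<and> J v = v"
    then obtain v where v: "v \<noteq> 0" "v = (- (K (E d v) / \<gamma> * vs)) *\<^sub>R v0" using fix_iff by blast
    then have K0: "K (E d v) \<noteq> 0" by force
    \<comment> \<open>Applying \<open>\<lambda>v. K (E d v)\<close> reduces the vector equation to a
      scalar one, from which the nonzero factor \<open>K (E d v)\<close> cancels.\<close>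
    have "K (E d v) = K (E d ((- (K (E d v) / \<gamma> * vs)) *\<^sub>R v0))" using v(2) by simp
    also have "\<dots> = (- (K (E d v) / \<gamma> * vs)) * K (E Ts u)"
      by (simp only: linear_scale[OF lin] linear_scale[OF K] Kv0 real_scaleR_def)
    finally have "K (E d v) * (\<gamma> + vs * K (E Ts u)) = 0"
      using \<gamma>0 by (simp add: field_simps)
    then show "\<gamma> = - vs * K (E Ts u)" using K0 by simp
  next
    assume *: "\<gamma> = - vs * K (E Ts u)"
    have "v0 = (- (K (E d v0) / \<gamma> * vs)) *\<^sub>R v0"
      using \<gamma>0 unfolding Kv0 * by simp
    moreover have "v0 \<noteq> 0"
      using Kv0 * \<gamma>0 linear_0[OF lin] linear_0[OF K] by auto
    ultimately show "\<exists>v. v \<noteq> 0 \<and> J v = v" using fix_iff by blast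
  qed
  finally show ?thesis unfolding \<gamma> d_def by auto
qed


text \<open>
  The complex vector \<open>p + \<i> q\<close> in the following lemmas is the Fourier coefficient, up to the factor
  \<open>1 / Ts\<close>, of the \<open>Ts\<close>-periodic extension of \<open>\<lambda>t. E t u\<close>, and \<open>(\<i> \<nu> - M) (p + \<i> q) = u - E Ts u\<close>
  is written in terms of real and imaginary parts.
\<close>

definition cos_coeff :: "real \<Rightarrow> 's \<Rightarrow> 's" where
  "cos_coeff \<nu> u = integral {0..Ts} (\<lambda>t. cos (\<nu> * t) *\<^sub>R E t u)"

text \<open>The sign is that of the imaginary part of \<open>cis (- \<nu> * t)\<close>.\<close>

definition sin_coeff :: "real \<Rightarrow> 's \<Rightarrow> 's" where
  "sin_coeff \<nu> u = - integral {0..Ts} (\<lambda>t. sin (\<nu> * t) *\<^sub>R E t u)"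

lemma has_integral_cos_sin:
  shows has_integral_cos: "((\<lambda>t. cos (\<nu> * t) *\<^sub>R E t u) has_integral cos_coeff \<nu> u) {0..Ts}"
    and has_integral_sin: "((\<lambda>t. sin (\<nu> * t) *\<^sub>R E t u) has_integral - sin_coeff \<nu> u) {0..Ts}"
  unfolding cos_coeff_def sin_coeff_def minus_minus
  by (intro integrable_integral integrable_continuous_real continuous_intros
      continuous_on_linear_flow[OF M])+

text \<open>Integrate the derivatives of \<open>cos (\<nu> * t) *\<^sub>R E t u\<close> and
  \<open>sin (\<nu> * t) *\<^sub>R E t u\<close> over one period; the boundary terms are
  \<open>E Ts u - u\<close> and zero.\<close>

lemma coeff_equations:
  assumes "cos (\<nu> * Ts) = 1" "sin (\<nu> * Ts) = 0"
  shows "M (cos_coeff \<nu> u) + \<nu> *\<^sub>R sin_coeff \<nu> u = E Ts u - u"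
    and "M (sin_coeff \<nu> u) = \<nu> *\<^sub>R cos_coeff \<nu> u"
proof -
  have bl: "bounded_linear M" using M by (simp add: linear_conv_bounded_linear)
  have E': "((\<lambda>t. E t u) has_vector_derivative M (E t u)) (at t within X)" for t X
    using linear_flow_deriv[OF M, of u t]
    by (simp add: linear_flow_commute[OF M] has_vector_derivative_at_within)
  have "((\<lambda>t. cos (\<nu> * t) *\<^sub>R M (E t u) + (- \<nu>) *\<^sub>R (sin (\<nu> * t) *\<^sub>R E t u)) has_integral
      (cos (\<nu> * Ts) *\<^sub>R E Ts u - cos (\<nu> * 0) *\<^sub>R E 0 u)) {0..Ts}"
    using Ts by (intro fundamental_theorem_of_calculus)
      (auto intro!: derivative_eq_intros E' simp: algebra_simps)
  moreover have "((\<lambda>t. cos (\<nu> * t) *\<^sub>R M (E t u) + (- \<nu>) *\<^sub>R (sin (\<nu> * t) *\<^sub>R E t u)) has_integral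
      (M (cos_coeff \<nu> u) + (- \<nu>) *\<^sub>R (- sin_coeff \<nu> u))) {0..Ts}"
    using has_integral_linear[OF has_integral_cos bl, of \<nu> u]
    by (intro has_integral_add has_integral_cmul has_integral_sin) (simp add: o_def linear_scale[OF M])
  ultimately show "M (cos_coeff \<nu> u) + \<nu> *\<^sub>R sin_coeff \<nu> u = E Ts u - u"
    using assms by (auto dest: has_integral_unique)
  have "((\<lambda>t. sin (\<nu> * t) *\<^sub>R M (E t u) + \<nu> *\<^sub>R (cos (\<nu> * t) *\<^sub>R E t u)) has_integral
      (sin (\<nu> * Ts) *\<^sub>R E Ts u - sin (\<nu> * 0) *\<^sub>R E 0 u)) {0..Ts}"
    using Ts by (intro fundamental_theorem_of_calculus)
      (auto intro!: derivative_eq_intros E' simp: algebra_simps)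
  moreover have "((\<lambda>t. sin (\<nu> * t) *\<^sub>R M (E t u) + \<nu> *\<^sub>R (cos (\<nu> * t) *\<^sub>R E t u)) has_integral
      (M (- sin_coeff \<nu> u) + \<nu> *\<^sub>R cos_coeff \<nu> u)) {0..Ts}"
    using has_integral_linear[OF has_integral_sin bl, of \<nu> u]
    by (intro has_integral_add has_integral_cmul has_integral_cos) (simp add: o_def linear_scale[OF M])
  ultimately have "M (- sin_coeff \<nu> u) + \<nu> *\<^sub>R cos_coeff \<nu> u = 0"
    using assms by (auto dest: has_integral_unique)
  then show "M (sin_coeff \<nu> u) = \<nu> *\<^sub>R cos_coeff \<nu> u"
    by (simp add: linear_neg[OF M])
qed

lemma integral_functional_cis:
  assumes "linear \<phi>"
  shows "integral {0..Ts} (\<lambda>t. of_real (\<phi> (E t u)) * cis (- \<nu> * t)) =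
    Complex (\<phi> (cos_coeff \<nu> u)) (\<phi> (sin_coeff \<nu> u))"
proof (rule integral_unique)
  have "bounded_linear (\<lambda>y. complex_of_real (\<phi> y))"
    using bounded_linear_compose[OF bounded_linear_of_real] assms
    by (simp add: linear_conv_bounded_linear)
  note int = has_integral_linear[OF _ this]
  have "((\<lambda>t. complex_of_real (\<phi> (cos (\<nu> * t) *\<^sub>R E t u)) - \<i> * complex_of_real (\<phi> (sin (\<nu> * t) *\<^sub>R E t u)))
     has_integral (complex_of_real (\<phi> (cos_coeff \<nu> u)) - \<i> * complex_of_real (\<phi> (- sin_coeff \<nu> u)))) {0..Ts}"
    using int[OF has_integral_cos] int[OF has_integral_sin]
    by (intro has_integral_diff has_integral_mult_right) (simp_all add: o_def)
  then show "((\<lambda>t. of_real (\<phi> (E t u)) * cis (- \<nu> * t)) has_integral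
    Complex (\<phi> (cos_coeff \<nu> u)) (\<phi> (sin_coeff \<nu> u))) {0..Ts}"
    by (rule has_integral_eq_rhs[OF has_integral_eq[rotated]])
      (simp_all add: linear_scale[OF assms] linear_neg[OF assms] complex_eq_iff)
qed

text \<open>The functional is arbitrary because two kinds occur: \<open>K\<close> for the loop gain,
  and inner products for showing that a flow with vanishing coefficients vanishes.\<close>

lemma Fourier_linear_flow:
  assumes "linear \<phi>" and \<omega>: "\<omega> = 2 * pi / Ts" and d: "0 < d" "d < Ts"
  shows "(\<lambda>N. \<Sum>n = - int N..int N. cis (of_int n * \<omega> * d) *
    (Complex (\<phi> (cos_coeff (of_int n * \<omega>) u)) (\<phi> (sin_coeff (of_int n * \<omega>) u)) / Ts))
      \<longlonglongrightarrow> of_real (\<phi> (E d u))"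
proof -
  define f where "f t = complex_of_real (\<phi> (E t u))" for t
  have bl: "bounded_linear (\<lambda>y. complex_of_real (\<phi> y))"
    using bounded_linear_compose[OF bounded_linear_of_real] assms
    by (simp add: linear_conv_bounded_linear)
  have f': "(f has_vector_derivative of_real (\<phi> (E t (M u)))) (at t)" for t
    using bounded_linear.has_vector_derivative[OF bl linear_flow_deriv[OF M]]
    by (simp add: f_def[abs_def])
  then have f: "continuous_on {0..Ts} f"
    by (intro continuous_at_imp_continuous_on ballI has_vector_derivative_continuous)
  show ?thesis
    using Fourier_series_at_differentiable_point[OF Ts d f f' \<omega>]
    unfolding f_def integral_functional_cis[OF assms(1)] .
qed

text \<open>Both hypotheses on \<open>p\<close> and \<open>q\<close> are real forms of statements
  about \<open>p + \<i> q\<close> at a harmonic \<open>\<nu>\<close>: \<open>\<i> \<nu> - M\<close>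
  is injective, and where it takes the value \<open>\<beta>\<close>, the functional \<open>K\<close>
  gives \<open>- G (\<i> \<nu>)\<close>.\<close>

theorem saddle_node_iff_harmonic_balance:
  assumes \<omega>: "\<omega> = 2 * pi / Ts" and D: "0 < D" "D < 1"
    and resonance_free: "\<And>(n::int) p q. M p + (of_int n * \<omega>) *\<^sub>R q = 0 \<Longrightarrow>
      M q = (of_int n * \<omega>) *\<^sub>R p \<Longrightarrow> p = 0 \<and> q = 0"
    and transfer: "\<And>(n::int) p q. M p + (of_int n * \<omega>) *\<^sub>R q = - \<beta> \<Longrightarrow>
      M q = (of_int n * \<omega>) *\<^sub>R p \<Longrightarrow> Complex (K p) (K q) = - G (\<i> * of_real (of_int n * \<omega>))"
    and steady: "periodic_steady_state S h Ts vs D x"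
    and trans: "transversal_switching S h Ts vs x"
  shows "saddle_node_bifurcation (sampled_data_map S h Ts vs) x \<longleftrightarrow>
    bilateral_sums (loop_gain_harmonic (loop_gain G vs Vh) D \<omega>) (-1)"
proof -
  have full: "cos (of_int n * \<omega> * Ts) = 1" "sin (of_int n * \<omega> * Ts) = 0" for n :: int
    using Ts cis_multiple_2pi[of "of_int n"] by (simp_all add: \<omega> mult_ac cis.ctr complex_eq_iff)
  \<comment> \<open>For a fixed vector of \<open>E Ts\<close> the coefficients solve the homogeneous
    equations and vanish. The Fourier series at the interior point \<open>Ts / 2\<close> then gives
    \<open>E (Ts / 2) v = 0\<close>.\<close>
  have no_periodic: "v = 0" if v: "E Ts v = v" for v
  proof -
    have zero: "cos_coeff (of_int n * \<omega>) v = 0 \<and> sin_coeff (of_int n * \<omega>) v = 0" for n :: int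
    proof (rule resonance_free[where n = n])
      show "M (cos_coeff (of_int n * \<omega>) v) + (of_int n * \<omega>) *\<^sub>R sin_coeff (of_int n * \<omega>) v = 0"
        unfolding coeff_equations[OF full] v by simp
    qed (rule coeff_equations[OF full])
    have "E (Ts / 2) v \<bullet> b = 0" for b
    proof -
      have "linear (\<lambda>y. y \<bullet> b)" by (simp add: linear_conv_bounded_linear bounded_linear_inner_left)
      from Fourier_linear_flow[OF this \<omega>, of "Ts / 2" v] Ts
      have "(\<lambda>N. 0) \<longlonglongrightarrow> complex_of_real (E (Ts / 2) v \<bullet> b)"
        by (simp add: zero zero_complex.code[symmetric])
      then show ?thesis by (simp add: LIMSEQ_const_iff)
    qed
    then have "E (Ts / 2) v = 0" using inner_eq_zero_iff by blast
    then show ?thesis using linear_flow_eq_0_iff[OF M] by blast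
  qed
  have "linear (\<lambda>v. v - E Ts v)" using lin by (intro linear_compose_sub) (simp_all add: linear_id[unfolded id_def])
  moreover have "inj (\<lambda>v. v - E Ts v)"
    using no_periodic calculation by (auto simp: linear_injective_0)
  ultimately have "surj (\<lambda>v. v - E Ts v)" using linear_injective_imp_surjective by blast
  then obtain u where u: "u - E Ts u = \<beta>" by (metis surjD)
  define d where "d = D * Ts"
  have d: "0 < d" "d < Ts" using D Ts by (simp_all add: d_def)
  define H where "H = loop_gain_harmonic (loop_gain G vs Vh) D \<omega>"
  \<comment> \<open>\<open>Ts\<close> undoes the normalization of the coefficients,
    \<open>vs / Vh\<close> turns \<open>G\<close> into the loop gain, and the sign is that in
    \<open>transfer\<close>.\<close>
  have "- (Ts * vs / Vh) * (cis (of_int n * \<omega> * d) *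
      (Complex (K (cos_coeff (of_int n * \<omega>) u)) (K (sin_coeff (of_int n * \<omega>) u)) / Ts)) = H n" for n :: int
  proof -
    have tr: "Complex (K (cos_coeff (of_int n * \<omega>) u)) (K (sin_coeff (of_int n * \<omega>) u))
      = - G (\<i> * of_real (of_int n * \<omega>))"
    proof (rule transfer[where n = n])
      show "M (cos_coeff (of_int n * \<omega>) u) + (of_int n * \<omega>) *\<^sub>R sin_coeff (of_int n * \<omega>) u = - \<beta>"
        unfolding coeff_equations[OF full] by (simp flip: u)
    qed (rule coeff_equations[OF full])
    have "of_int n * \<omega> * d = 2 * of_int n * pi * D" using Ts by (simp add: \<omega> d_def)
    then have "H n = cis (of_int n * \<omega> * d) * (G (\<i> * of_real (of_int n * \<omega>)) * vs / Vh)"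
      by (simp only: H_def loop_gain_harmonic_def loop_gain_def cis_conv_exp)
    then show ?thesis unfolding tr using Ts by simp
  qed
  then have "(\<lambda>N. \<Sum>n = - int N..int N. H n) \<longlonglongrightarrow>
      complex_of_real (- (Ts * vs / Vh)) * complex_of_real (K (E d u))"
    using tendsto_mult_left[OF Fourier_linear_flow[OF K \<omega> d, of u], of "- (Ts * vs / Vh)"]
    by (simp only: sum_distrib_left)
  then have "(\<lambda>N. \<Sum>n = - int N..int N. H n) \<longlonglongrightarrow> of_real (- (Ts * vs / Vh) * K (E d u))"
    by (simp only: of_real_mult)
  \<comment> \<open>The series converges in any case, so the condition only compares its limit with
    -1.\<close>
  then have "bilateral_sums H (-1) \<longleftrightarrow> complex_of_real (- (Ts * vs / Vh) * K (E d u)) = -1"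
    unfolding bilateral_sums_def by (auto dest: LIMSEQ_unique)
  also have "\<dots> \<longleftrightarrow> - (Ts * vs / Vh) * K (E d u) = -1"
    by (subst of_real_eq_iff[where 'a = complex, symmetric]) (simp only: of_real_minus of_real_1)
  also have "\<dots> \<longleftrightarrow> vs * K (E d u) = Vh / Ts"
    using Ts Vh by (auto simp: field_simps)
  finally show ?thesis
    using steady_state_saddle_node_iff[OF steady trans D no_periodic u] by (simp add: H_def d_def)
qed

end

subsection \<open>Buck converters\<close>

lemma linear_output_voltage: "linear (output_voltage R Rc)"
  by (rule linearI) (simp_all add: output_voltage_def algebra_simps)

lemma linear_power_stage: "linear (power_stage L C R Rc 0)"
  by (rule linearI)
    (simp_all add: power_stage_def linear_add[OF linear_output_voltage] linear_scale[OF linear_output_voltage]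
      add_divide_distrib diff_divide_distrib right_diff_distrib)

lemma power_stage_affine:
  "power_stage L C R Rc vd p = power_stage L C R Rc 0 p + vd *\<^sub>R (1 / L, 0)"
  by (simp add: power_stage_def diff_divide_distrib)

text \<open>Damping makes the imaginary part a nonzero multiple of \<open>\<nu>\<close>, and at
  \<open>\<nu> = 0\<close> the value is 1.\<close>

lemma buck_denominator_nonzero:
  fixes \<nu> :: real
  assumes "L > 0" "C > 0" "R > 0" "Rc \<ge> 0"
  shows "buck_denominator L C R Rc (\<i> * of_real \<nu>) \<noteq> 0"
proof
  assume *: "buck_denominator L C R Rc (\<i> * of_real \<nu>) = 0"
  have "Im (buck_denominator L C R Rc (\<i> * of_real \<nu>)) = (L / R + Rc * C) * \<nu>"
    by (simp add: buck_denominator_def power2_eq_square)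
  moreover have "L / R + Rc * C > 0" using assms by (intro add_pos_nonneg) auto
  ultimately have "\<nu> = 0" using * by simp
  with * show False by (simp add: buck_denominator_def)
qed

text \<open>\<open>p + \<i> q\<close> is the complex amplitude of the state when the switched
  voltage has amplitude \<open>g\<close> at frequency \<open>\<nu>\<close>. The case
  \<open>g = 1\<close> gives the transfer functions, \<open>g = 0\<close> the absence of
  resonance.\<close>

lemma power_stage_harmonic:
  fixes \<nu> g :: real
  assumes pos: "L > 0" "C > 0" "R > 0" "Rc \<ge> 0"
    and p: "power_stage L C R Rc 0 p + \<nu> *\<^sub>R q = - g *\<^sub>R (1 / L, 0)"
    and q: "power_stage L C R Rc 0 q = \<nu> *\<^sub>R p"
  defines "s \<equiv> \<i> * of_real \<nu>"
  shows "Complex (output_voltage R Rc p) (output_voltage R Rc q) = of_real g * Gv L C R Rc s"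
    and "Complex (fst p) (fst q) = of_real g * Gi L C R Rc s"
proof -
  define I where "I = Complex (fst p) (fst q)"
  define V where "V = Complex (snd p) (snd q)"
  define Vo where "Vo = Complex (output_voltage R Rc p) (output_voltage R Rc q)"
  have nz: "L \<noteq> 0" "C \<noteq> 0" "R \<noteq> 0" "R + Rc \<noteq> 0" using pos by auto
  have "(g - output_voltage R Rc p) / L = - (\<nu> * fst q)" "- output_voltage R Rc q / L = \<nu> * fst p"
    using arg_cong[OF p, of fst] arg_cong[OF q, of fst]
    by (simp_all add: power_stage_def diff_divide_distrib)
  then have inductor: "s * L * I = g - Vo"
    using nz by (auto simp: s_def I_def Vo_def complex_eq_iff field_simps)
  have "(fst p - output_voltage R Rc p / R) / C = - (\<nu> * snd q)"
    "(fst q - output_voltage R Rc q / R) / C = \<nu> * snd p"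
    using arg_cong[OF p, of snd] arg_cong[OF q, of snd] by (simp_all add: power_stage_def)
  then have capacitor: "s * C * V = I - Vo / R"
    using nz by (auto simp: s_def I_def Vo_def V_def complex_eq_iff field_simps)
  have "(1 + Rc / R) * (R / (R + Rc)) = (R + Rc) / R * (R / (R + Rc))"
    using nz by (simp add: add_divide_distrib[of R Rc R])
  then have "(1 + Rc / R) * (R / (R + Rc)) = 1" using nz by simp
  then have "(1 + Rc / R) * output_voltage R Rc x = snd x + Rc * fst x" for x
    by (simp only: output_voltage_def mult.assoc[symmetric] mult_1)
  then have out: "of_real (1 + Rc / R) * Vo = V + Rc * I"
    by (simp only: I_def Vo_def V_def complex_eq_iff) simp
  \<comment> \<open>\<open>N\<close> and \<open>Z\<close> are the numerators of \<open>Gi\<close>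
    and \<open>Gv\<close>. Eliminating the capacitor voltage \<open>V\<close> gives
    \<open>Z * I = N * Vo\<close>; the inductor equation then produces the denominator as
    \<open>Z + s * L * N\<close>.\<close>
  define N where "N = of_real ((1 + Rc / R) * C) * s + of_real (1 / R)"
  define Z where "Z = s * of_real (Rc * C) + 1"
  have \<Delta>: "buck_denominator L C R Rc s = Z + s * L * N"
    using nz by (simp add: buck_denominator_def Z_def N_def power2_eq_square field_simps)
  have \<Delta>0: "buck_denominator L C R Rc s \<noteq> 0"
    unfolding s_def by (rule buck_denominator_nonzero[OF pos])
  have "s * C * (of_real (1 + Rc / R) * Vo) = I - Vo / R + s * C * Rc * I"
    unfolding out using capacitor by (simp add: algebra_simps)
  then have IZ: "Z * I = N * Vo"
    by (simp add: Z_def N_def algebra_simps)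
  have "buck_denominator L C R Rc s * Vo = Z * Vo + s * L * (N * Vo)"
    by (simp add: \<Delta> algebra_simps)
  also have "\<dots> = Z * (Vo + s * L * I)" by (simp add: IZ[symmetric] algebra_simps)
  also have "\<dots> = g * Z" by (simp add: inductor)
  finally show "Vo = of_real g * Gv L C R Rc s"
    using \<Delta>0 by (simp add: Gv_def Z_def field_simps)
  have "buck_denominator L C R Rc s * I = N * (Vo + s * L * I)"
    using IZ by (simp add: \<Delta> algebra_simps)
  also have "\<dots> = g * N" by (simp add: inductor)
  finally show "I = of_real g * Gi L C R Rc s"
    using \<Delta>0 by (simp add: Gi_def N_def field_simps)
qed

lemma power_stage_resonance_free:
  assumes pos: "L > 0" "C > 0" "R > 0" "Rc \<ge> 0"
    and p: "power_stage L C R Rc 0 p + \<nu> *\<^sub>R q = 0"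
    and q: "power_stage L C R Rc 0 q = \<nu> *\<^sub>R p"
  shows "p = 0 \<and> q = 0"
proof -
  have "output_voltage R Rc p = 0" "output_voltage R Rc q = 0" "fst p = 0" "fst q = 0"
    using power_stage_harmonic[OF pos, of p \<nu> q 0] p q
    by (simp_all add: complex_eq_iff flip: zero_prod_def)
  then show ?thesis using pos by (auto simp: output_voltage_def prod_eq_iff)
qed

section \<open>Power stage in cascade with the compensator\<close>

lemma linear_compensated_field: "linear (compensated_field L C R Rc A b 0 0)"
  by (rule linearI)
    (simp_all add: compensated_field_def linear_add[OF linear_power_stage] linear_scale[OF linear_power_stage]
      linear_add[OF linear_output_voltage] linear_scale[OF linear_output_voltage]
      matrix_vector_right_distrib matrix_vector_mult_scaleR scaleR_diff_left scaleR_diff_right)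

lemma compensated_field_affine:
  "compensated_field L C R Rc A b vr vd x =
    compensated_field L C R Rc A b 0 0 x + (vd *\<^sub>R ((1 / L, 0), 0) + (0, vr *\<^sub>R b))"
  by (simp add: compensated_field_def power_stage_affine[of _ _ _ _ vd] scaleR_diff_left)

lemma linear_voltage_compensator_output: "linear (voltage_compensator_output R Rc c \<delta> 0)"
  by (rule linearI)
    (simp_all add: voltage_compensator_output_def linear_add[OF linear_output_voltage]
      linear_scale[OF linear_output_voltage] inner_add_right algebra_simps)

lemma voltage_compensator_output_affine:
  "voltage_compensator_output R Rc c \<delta> vr x = voltage_compensator_output R Rc c \<delta> 0 x + \<delta> * vr"
  by (simp add: voltage_compensator_output_def algebra_simps)

lemma matrix_inv_mult_left:
  fixes X :: "'a::semiring_1^'n^'m"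
  assumes "invertible X"
  shows "matrix_inv X ** X = mat 1"
  using someI_ex[OF assms[unfolded invertible_def]] by (simp add: matrix_inv_def)

text \<open>The hypotheses are the real and imaginary parts of
  \<open>(\<i> \<nu> - A) W = - (e + \<i> e') b\<close>. The sign arises because the compensator is
  driven by the negative of the output voltage, whose amplitude is
  \<open>e + \<i> e'\<close>.\<close>

lemma compensator_harmonic:
  fixes A :: "real^'m^'m" and b w w' :: "real^'m" and \<nu> e e' :: real
  assumes inv: "invertible (characteristic_matrix A (\<i> * of_real \<nu>))"
    and w: "A *v w - e *\<^sub>R b + \<nu> *\<^sub>R w' = 0" and w': "A *v w' - e' *\<^sub>R b = \<nu> *\<^sub>R w"
  shows "(\<chi> i. Complex (w $ i) (w' $ i)) =
    (- Complex e e') *s (matrix_inv (characteristic_matrix A (\<i> * of_real \<nu>)) *v (\<chi> k. of_real (b $ k)))"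
proof -
  define X where "X = characteristic_matrix A (\<i> * of_real \<nu>)"
  define W where "W = (\<chi> i. Complex (w $ i) (w' $ i))"
  have "X *v W = (- Complex e e') *s (\<chi> k. of_real (b $ k))"
  proof (subst vec_eq_iff, intro allI)
    fix i
    have 1: "(\<Sum>j\<in>UNIV. A $ i $ j * w $ j) = e * b $ i - \<nu> * w' $ i"
      using arg_cong[OF w, of "\<lambda>v. v $ i"] by (simp add: matrix_vector_mult_def algebra_simps)
    have 2: "(\<Sum>j\<in>UNIV. A $ i $ j * w' $ j) = e' * b $ i + \<nu> * w $ i"
      using arg_cong[OF w', of "\<lambda>v. v $ i"] by (simp add: matrix_vector_mult_def algebra_simps)
    have "(\<Sum>j\<in>UNIV. of_real (A $ i $ j) * Complex (w $ j) (w' $ j)) =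
      Complex (\<Sum>j\<in>UNIV. A $ i $ j * w $ j) (\<Sum>j\<in>UNIV. A $ i $ j * w' $ j)"
      by (simp add: complex_eq_iff)
    moreover have "(mat k *v W) $ i = k * W $ i" for k
      by (simp add: matrix_vector_mult_def mat_def if_distrib if_distribR cong: if_cong)
    then have "(X *v W) $ i = \<i> * of_real \<nu> * Complex (w $ i) (w' $ i)
      - (\<Sum>j\<in>UNIV. of_real (A $ i $ j) * Complex (w $ j) (w' $ j))"
      by (simp add: X_def W_def characteristic_matrix_def matrix_vector_mult_diff_rdistrib)
        (simp add: matrix_vector_mult_def)
    ultimately show "(X *v W) $ i = ((- Complex e e') *s (\<chi> k. of_real (b $ k))) $ i"
      unfolding 1 2 by (simp add: complex_eq_iff algebra_simps)
  qed
  then have "matrix_inv X *v (X *v W) = (- Complex e e') *s (matrix_inv X *v (\<chi> k. of_real (b $ k)))"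
    by (simp only: vector_scalar_commute)
  then show ?thesis
    using inv by (simp add: W_def X_def matrix_vector_mul_assoc matrix_inv_mult_left)
qed

lemma compensator_output_harmonic:
  fixes A :: "real^'m^'m" and b c w w' :: "real^'m" and \<nu> e e' \<delta> :: real
  assumes "invertible (characteristic_matrix A (\<i> * of_real \<nu>))"
    and "A *v w - e *\<^sub>R b + \<nu> *\<^sub>R w' = 0" and "A *v w' - e' *\<^sub>R b = \<nu> *\<^sub>R w"
  shows "Complex (c \<bullet> w - \<delta> * e) (c \<bullet> w' - \<delta> * e') = - (Gc A b c \<delta> (\<i> * of_real \<nu>) * Complex e e')"
proof -
  let ?r = "matrix_inv (characteristic_matrix A (\<i> * of_real \<nu>)) *v (\<chi> k. of_real (b $ k))"
  have W: "Complex (w $ i) (w' $ i) = - (Complex e e' * ?r $ i)" for i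
    using arg_cong[OF compensator_harmonic[OF assms], of "\<lambda>v. v $ i"] by simp
  have "Complex (c \<bullet> w - \<delta> * e) (c \<bullet> w' - \<delta> * e') =
    (\<Sum>i\<in>UNIV. of_real (c $ i) * Complex (w $ i) (w' $ i)) - of_real \<delta> * Complex e e'"
    by (simp add: complex_eq_iff inner_vec_def)
  also have "\<dots> = - (Gc A b c \<delta> (\<i> * of_real \<nu>) * Complex e e')"
    unfolding W by (simp add: Gc_def algebra_simps sum_distrib_left sum_negf)
  finally show ?thesis .
qed

context
  fixes L C R Rc :: real and A :: "real^'m^'m" and b :: "real^'m" and \<nu> :: real
  assumes pos: "L > 0" "C > 0" "R > 0" "Rc \<ge> 0"
    and inv: "invertible (characteristic_matrix A (\<i> * of_real \<nu>))"
begin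

text \<open>The power stage does not see the compensator state, so its amplitude vanishes first, and
  the compensator is left without input.\<close>

lemma compensated_field_resonance_free:
  assumes p: "compensated_field L C R Rc A b 0 0 p + \<nu> *\<^sub>R q = 0"
    and q: "compensated_field L C R Rc A b 0 0 q = \<nu> *\<^sub>R p"
  shows "p = 0 \<and> q = 0"
proof -
  have pq: "fst p = 0 \<and> fst q = 0"
    using arg_cong[OF p, of fst] arg_cong[OF q, of fst]
    by (intro power_stage_resonance_free[OF pos, where \<nu> = \<nu>]) (simp_all add: compensated_field_def)
  then have "A *v snd p - 0 *\<^sub>R b + \<nu> *\<^sub>R snd q = 0" "A *v snd q - 0 *\<^sub>R b = \<nu> *\<^sub>R snd p"
    using arg_cong[OF p, of snd] arg_cong[OF q, of snd] linear_0[OF linear_output_voltage]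
    by (simp_all add: compensated_field_def)
  from compensator_harmonic[OF inv this]
  have "Complex (snd p $ i) (snd q $ i) = 0" for i
    by (simp add: vec_eq_iff zero_complex.code[symmetric])
  then have "snd p = 0 \<and> snd q = 0" by (simp add: vec_eq_iff complex_eq_iff)
  with pq show ?thesis by (simp add: prod_eq_iff)
qed

lemma compensated_field_harmonic:
  assumes p: "compensated_field L C R Rc A b 0 0 p + \<nu> *\<^sub>R q = - ((1 / L, 0), 0)"
    and q: "compensated_field L C R Rc A b 0 0 q = \<nu> *\<^sub>R p"
  shows "Complex (voltage_compensator_output R Rc c \<delta> 0 p) (voltage_compensator_output R Rc c \<delta> 0 q)
      = - (Gc A b c \<delta> (\<i> * of_real \<nu>) * Gv L C R Rc (\<i> * of_real \<nu>))"
    and "Complex (fst (fst p)) (fst (fst q)) = Gi L C R Rc (\<i> * of_real \<nu>)"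
proof -
  have ps: "power_stage L C R Rc 0 (fst p) + \<nu> *\<^sub>R fst q = - 1 *\<^sub>R (1 / L, 0)"
    "power_stage L C R Rc 0 (fst q) = \<nu> *\<^sub>R fst p"
    using arg_cong[OF p, of fst] arg_cong[OF q, of fst] by (simp_all add: compensated_field_def)
  note h = power_stage_harmonic[OF pos ps]
  show "Complex (fst (fst p)) (fst (fst q)) = Gi L C R Rc (\<i> * of_real \<nu>)"
    using h(2) by simp
  have "A *v snd p - output_voltage R Rc (fst p) *\<^sub>R b + \<nu> *\<^sub>R snd q = 0"
    "A *v snd q - output_voltage R Rc (fst q) *\<^sub>R b = \<nu> *\<^sub>R snd p"
    using arg_cong[OF p, of snd] arg_cong[OF q, of snd] by (simp_all add: compensated_field_def)
  from compensator_output_harmonic[OF inv this, of c \<delta>] h(1)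
  show "Complex (voltage_compensator_output R Rc c \<delta> 0 p) (voltage_compensator_output R Rc c \<delta> 0 q)
      = - (Gc A b c \<delta> (\<i> * of_real \<nu>) * Gv L C R Rc (\<i> * of_real \<nu>))"
    by (simp add: voltage_compensator_output_def)
qed

end

section \<open>The three control schemes\<close>

context
  fixes L C R Rc vs Vl Vh Ts D \<omega> :: real
  assumes pos: "L > 0" "C > 0" "R > 0" "Rc \<ge> 0"
    and "vs > 0" "Vh > 0" "Ts > 0"
    and D: "0 < D" "D < 1"
    and \<omega>: "\<omega> = 2 * pi / Ts"
begin

lemma voltage_mode_saddle_node_iff:
  fixes A :: "real^'m^'m"
  assumes inv: "\<And>n::int. invertible (characteristic_matrix A (\<i> * of_real (of_int n * \<omega>)))"
    and steady: "periodic_steady_state (voltage_mode L C R Rc A b c \<delta> vr) (ramp Vl Vh Ts) Ts vs D x"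
    and trans: "transversal_switching (voltage_mode L C R Rc A b c \<delta> vr) (ramp Vl Vh Ts) Ts vs x"
  shows "saddle_node_bifurcation
      (sampled_data_map (voltage_mode L C R Rc A b c \<delta> vr) (ramp Vl Vh Ts) Ts vs) x \<longleftrightarrow>
    bilateral_sums (loop_gain_harmonic
      (loop_gain (\<lambda>s. Gc A b c \<delta> s * Gv L C R Rc s) vs Vh) D \<omega>) (-1)"
proof (rule switched_affine_converter.saddle_node_iff_harmonic_balance[OF _ \<omega> D _ _ steady trans])
  show "switched_affine_converter (voltage_mode L C R Rc A b c \<delta> vr) (compensated_field L C R Rc A b 0 0)
    ((1 / L, 0), 0) (0, vr *\<^sub>R b) (voltage_compensator_output R Rc c \<delta> 0) (\<delta> * vr) Ts vs Vh"
  proof (rule switched_affine_converter.intro)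
    show "vfield (voltage_mode L C R Rc A b c \<delta> vr) =
      (\<lambda>v x. compensated_field L C R Rc A b 0 0 x + (v *\<^sub>R ((1 / L, 0), 0) + (0, vr *\<^sub>R b)))"
      by (intro ext) (simp only: voltage_mode_def converter.simps compensated_field_affine[of _ _ _ _ _ _ vr])
    show "comp_output (voltage_mode L C R Rc A b c \<delta> vr) =
      (\<lambda>x. voltage_compensator_output R Rc c \<delta> 0 x + \<delta> * vr)"
      by (intro ext) (simp only: voltage_mode_def converter.simps voltage_compensator_output_affine[of _ _ _ _ vr])
  qed (rule linear_compensated_field linear_voltage_compensator_output \<open>vs > 0\<close> \<open>Vh > 0\<close> \<open>Ts > 0\<close>)+
next
  fix n :: int and p q
  assume "compensated_field L C R Rc A b 0 0 p + (of_int n * \<omega>) *\<^sub>R q = 0"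
    "compensated_field L C R Rc A b 0 0 q = (of_int n * \<omega>) *\<^sub>R p"
  then show "p = 0 \<and> q = 0" by (rule compensated_field_resonance_free[OF pos inv])
next
  fix n :: int and p q
  assume "compensated_field L C R Rc A b 0 0 p + (of_int n * \<omega>) *\<^sub>R q = - ((1 / L, 0), 0)"
    "compensated_field L C R Rc A b 0 0 q = (of_int n * \<omega>) *\<^sub>R p"
  then show "Complex (voltage_compensator_output R Rc c \<delta> 0 p) (voltage_compensator_output R Rc c \<delta> 0 q) =
      - (Gc A b c \<delta> (\<i> * of_real (of_int n * \<omega>)) * Gv L C R Rc (\<i> * of_real (of_int n * \<omega>)))"
    by (rule compensated_field_harmonic(1)[OF pos inv])
qed

lemma current_mode_open_saddle_node_iff:
  assumes steady: "periodic_steady_state (current_mode_open L C R Rc ic) (ramp Vl Vh Ts) Ts vs D x"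
    and trans: "transversal_switching (current_mode_open L C R Rc ic) (ramp Vl Vh Ts) Ts vs x"
  shows "saddle_node_bifurcation
      (sampled_data_map (current_mode_open L C R Rc ic) (ramp Vl Vh Ts) Ts vs) x \<longleftrightarrow>
    bilateral_sums (loop_gain_harmonic (loop_gain (Gi L C R Rc) vs Vh) D \<omega>) (-1)"
proof (rule switched_affine_converter.saddle_node_iff_harmonic_balance[OF _ \<omega> D _ _ steady trans])
  show "switched_affine_converter (current_mode_open L C R Rc ic) (power_stage L C R Rc 0)
    (1 / L, 0) 0 (\<lambda>p. - fst p) ic Ts vs Vh"
  proof (rule switched_affine_converter.intro)
    show "vfield (current_mode_open L C R Rc ic) =
      (\<lambda>v x. power_stage L C R Rc 0 x + (v *\<^sub>R (1 / L, 0) + 0))"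
      by (intro ext) (simp only: current_mode_open_def converter.simps add_0_right flip: power_stage_affine)
    show "comp_output (current_mode_open L C R Rc ic) = (\<lambda>p. - fst p + ic)"
      by (simp add: current_mode_open_def)
    show "linear (\<lambda>p :: real \<times> real. - fst p)" by (rule linearI) simp_all
  qed (rule linear_power_stage \<open>vs > 0\<close> \<open>Vh > 0\<close> \<open>Ts > 0\<close>)+
next
  fix n :: int and p q
  assume "power_stage L C R Rc 0 p + (of_int n * \<omega>) *\<^sub>R q = 0"
    "power_stage L C R Rc 0 q = (of_int n * \<omega>) *\<^sub>R p"
  then show "p = 0 \<and> q = 0" by (rule power_stage_resonance_free[OF pos])
next
  fix n :: int and p q
  assume *: "power_stage L C R Rc 0 p + (of_int n * \<omega>) *\<^sub>R q = - (1 / L, 0)"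
    "power_stage L C R Rc 0 q = (of_int n * \<omega>) *\<^sub>R p"
  have "Complex (fst p) (fst q) = of_real 1 * Gi L C R Rc (\<i> * of_real (of_int n * \<omega>))"
    by (rule power_stage_harmonic(2)[OF pos _ *(2)]) (simp add: *(1))
  then show "Complex (- fst p) (- fst q) = - Gi L C R Rc (\<i> * of_real (of_int n * \<omega>))"
    by (simp add: complex_eq_iff)
qed

lemma current_mode_closed_saddle_node_iff:
  fixes A :: "real^'m^'m"
  assumes inv: "\<And>n::int. invertible (characteristic_matrix A (\<i> * of_real (of_int n * \<omega>)))"
    and steady: "periodic_steady_state (current_mode_closed L C R Rc A b c \<delta> vr) (ramp Vl Vh Ts) Ts vs D x"
    and trans: "transversal_switching (current_mode_closed L C R Rc A b c \<delta> vr) (ramp Vl Vh Ts) Ts vs x"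
  shows "saddle_node_bifurcation
      (sampled_data_map (current_mode_closed L C R Rc A b c \<delta> vr) (ramp Vl Vh Ts) Ts vs) x \<longleftrightarrow>
    bilateral_sums (loop_gain_harmonic
      (loop_gain (\<lambda>s. Gc A b c \<delta> s * Gv L C R Rc s + Gi L C R Rc s) vs Vh) D \<omega>) (-1)"
proof (rule switched_affine_converter.saddle_node_iff_harmonic_balance[OF _ \<omega> D _ _ steady trans])
  let ?K = "\<lambda>x. voltage_compensator_output R Rc c \<delta> 0 x - fst (fst x)"
  show "switched_affine_converter (current_mode_closed L C R Rc A b c \<delta> vr) (compensated_field L C R Rc A b 0 0)
    ((1 / L, 0), 0) (0, vr *\<^sub>R b) ?K (\<delta> * vr) Ts vs Vh"
  proof (rule switched_affine_converter.intro)
    show "vfield (current_mode_closed L C R Rc A b c \<delta> vr) =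
      (\<lambda>v x. compensated_field L C R Rc A b 0 0 x + (v *\<^sub>R ((1 / L, 0), 0) + (0, vr *\<^sub>R b)))"
      by (intro ext) (simp only: current_mode_closed_def converter.simps compensated_field_affine[of _ _ _ _ _ _ vr])
    show "comp_output (current_mode_closed L C R Rc A b c \<delta> vr) = (\<lambda>x. ?K x + \<delta> * vr)"
      by (simp add: current_mode_closed_def voltage_compensator_output_affine[of _ _ _ _ vr] fun_eq_iff)
    show "linear ?K"
      by (intro linear_compose_sub linear_voltage_compensator_output) (rule linearI; simp)
  qed (rule linear_compensated_field \<open>vs > 0\<close> \<open>Vh > 0\<close> \<open>Ts > 0\<close>)+
next
  fix n :: int and p q
  assume "compensated_field L C R Rc A b 0 0 p + (of_int n * \<omega>) *\<^sub>R q = 0"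
    "compensated_field L C R Rc A b 0 0 q = (of_int n * \<omega>) *\<^sub>R p"
  then show "p = 0 \<and> q = 0" by (rule compensated_field_resonance_free[OF pos inv])
next
  fix n :: int and p q
  assume *: "compensated_field L C R Rc A b 0 0 p + (of_int n * \<omega>) *\<^sub>R q = - ((1 / L, 0), 0)"
    "compensated_field L C R Rc A b 0 0 q = (of_int n * \<omega>) *\<^sub>R p"
  show "Complex (voltage_compensator_output R Rc c \<delta> 0 p - fst (fst p))
      (voltage_compensator_output R Rc c \<delta> 0 q - fst (fst q)) =
    - (Gc A b c \<delta> (\<i> * of_real (of_int n * \<omega>)) * Gv L C R Rc (\<i> * of_real (of_int n * \<omega>))
      + Gi L C R Rc (\<i> * of_real (of_int n * \<omega>)))"
    using compensated_field_harmonic(1)[OF pos inv *, of c \<delta>] compensated_field_harmonic(2)[OF pos inv *]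
    by (simp add: complex_eq_iff)
qed

end

theorem theorem3:
  fixes L C R Rc vs Vl Vh Ts D \<omega>s vr ic \<delta> :: real
    and A :: "real^'m^'m" and b c :: "real^'m"
    and h :: "real \<Rightarrow> real"
  assumes "L > 0" and "C > 0" and "R > 0" and "Rc \<ge> 0"
    and "vs > 0" and "Vh > 0" and "Ts > 0" and "0 < D" and "D < 1"
    and "\<omega>s = 2 * pi / Ts"
    and "h = ramp Vl Vh Ts"
  shows
    "(\<forall>x S T.
        S = voltage_mode L C R Rc A b c \<delta> vr \<longrightarrow>
        T = loop_gain (\<lambda>s. Gc A b c \<delta> s * Gv L C R Rc s) vs Vh \<longrightarrow>
        (\<forall>n::int. invertible (characteristic_matrix A (\<i> * of_real (of_int n * \<omega>s)))) \<longrightarrow>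
        periodic_steady_state S h Ts vs D x \<longrightarrow>
        transversal_switching S h Ts vs x \<longrightarrow>
        (saddle_node_bifurcation (sampled_data_map S h Ts vs) x \<longleftrightarrow>
         bilateral_sums (loop_gain_harmonic T D \<omega>s) (-1))) \<and>
     (\<forall>x S T.
        S = current_mode_open L C R Rc ic \<longrightarrow>
        T = loop_gain (Gi L C R Rc) vs Vh \<longrightarrow>
        periodic_steady_state S h Ts vs D x \<longrightarrow>
        transversal_switching S h Ts vs x \<longrightarrow>
        (saddle_node_bifurcation (sampled_data_map S h Ts vs) x \<longleftrightarrow>
         bilateral_sums (loop_gain_harmonic T D \<omega>s) (-1))) \<and>
     (\<forall>x S T.
        S = current_mode_closed L C R Rc A b c \<delta> vr \<longrightarrow>
        T = loop_gain (\<lambda>s. Gc A b c \<delta> s * Gv L C R Rc s + Gi L C R Rc s) vs Vh \<longrightarrow>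
        (\<forall>n::int. invertible (characteristic_matrix A (\<i> * of_real (of_int n * \<omega>s)))) \<longrightarrow>
        periodic_steady_state S h Ts vs D x \<longrightarrow>
        transversal_switching S h Ts vs x \<longrightarrow>
        (saddle_node_bifurcation (sampled_data_map S h Ts vs) x \<longleftrightarrow>
         bilateral_sums (loop_gain_harmonic T D \<omega>s) (-1)))"
  unfolding \<open>h = ramp Vl Vh Ts\<close>
  by (intro conjI allI impI; hypsubst;
      rule voltage_mode_saddle_node_iff[OF assms(1-10)] current_mode_open_saddle_node_iff[OF assms(1-10)]
        current_mode_closed_saddle_node_iff[OF assms(1-10)]; blast)

end
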